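(* Let $F/k$ be a field extension such that $k$ has positive characteristic and at most countably many elements. Suppose that $F/k$ is a separably generated extension of infinite transcendence degree. If $S$ is a $k$-subalgebra of $F$ with quotient field $F$ and $K$ is a torsion-free $S$-module of at most countable rank, then there exists a subring $R$ of $S$ that is strongly twisted by $K$.
   Context: All rings are commutative with identity. For a domain $S$ with quotient field $F$ and a torsion-free $S$-module $K$, $FK$ denotes the divisible hull $F\otimes_S K$ (which contains $K$), and the rank of $K$ is $\dim_F FK$. A derivation $D$ from a ring $B$ to a $B$-module $L$ is an additive map with $D(st)=sD(t)+tD(s)$ for all $s,t\in B$. A subring $R$ of $S$ is strongly twisted by $K$ if there is a derivation $D:F\to FK$ such that: (a) $R=S\cap D^{-1}(K)$; (b) $D(F)$ generates $FK$ as an $F$-vector space; and (c) $S\subseteq \operatorname{Ker} D+sS$ for all $0\neq s\in S$. A field extension $F/k$ is separably generated if there is a transcendence basis $B$ of $F$ over $k$ such that $F$ is separable algebraic over $k(B)$. *)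

theory Defs
  imports
    "HOL-Computational_Algebra.Computational_Algebra"
    "HOL-Library.Poly_Mapping"
    "HOL-Library.Set_Algebras"
    "HOL-Library.Countable_Set"
begin

section \<open>Subrings and subfields of a field\<close>

text \<open>The big field \<open>F\<close> is the universe of a type of class \<open>field\<close>; subfields \<open>k\<close> and subrings
  \<open>S\<close> are subsets of it.\<close>

definition is_subring :: "'f::field set \<Rightarrow> bool" where
  "is_subring R \<longleftrightarrow> 1 \<in> R \<and> (\<forall>x\<in>R. \<forall>y\<in>R. x - y \<in> R \<and> x * y \<in> R)"

definition is_subfield :: "'f::field set \<Rightarrow> bool" where
  "is_subfield L \<longleftrightarrow> is_subring L \<and> (\<forall>x\<in>L. inverse x \<in> L)"

definition is_subalgebra :: "'f::field set \<Rightarrow> 'f set \<Rightarrow> bool" where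
  "is_subalgebra k S \<longleftrightarrow> is_subring S \<and> k \<subseteq> S"

definition has_quotient_field_UNIV :: "'f::field set \<Rightarrow> bool" where
  "has_quotient_field_UNIV S \<longleftrightarrow> (\<forall>f. \<exists>a\<in>S. \<exists>b\<in>S - {0}. f = a / b)"

definition field_adjoin :: "'f::field set \<Rightarrow> 'f set \<Rightarrow> 'f set" where
  "field_adjoin k B = \<Inter>{L. is_subfield L \<and> k \<subseteq> L \<and> B \<subseteq> L}"

section \<open>Algebraic and separable elements, transcendence bases\<close>

definition polys_over :: "'f::field set \<Rightarrow> 'f poly set" where
  "polys_over L = {p. set (coeffs p) \<subseteq> L}"

definition algebraic_over :: "'f::field set \<Rightarrow> 'f \<Rightarrow> bool" where
  "algebraic_over L x \<longleftrightarrow> (\<exists>p\<in>polys_over L. p \<noteq> 0 \<and> poly p x = 0)"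

definition is_min_poly :: "'f::field set \<Rightarrow> 'f \<Rightarrow> 'f poly \<Rightarrow> bool" where
  "is_min_poly L x p \<longleftrightarrow>
     p \<in> polys_over L \<and> lead_coeff p = 1 \<and> poly p x = 0 \<and>
     (\<forall>q\<in>polys_over L. q \<noteq> 0 \<and> poly q x = 0 \<longrightarrow> Polynomial.degree p \<le> Polynomial.degree q)"

text \<open>\<open>x\<close> is separable over \<open>L\<close>: it is algebraic over \<open>L\<close> and its minimal polynomial \<open>p\<close> is prime to
  its derivative.  Coprimality is taken in \<open>F[X]\<close>; as gcds do not change under extension of the
  coefficient field, this is the same as coprimality in \<open>L[X]\<close>.\<close>

definition separable_over :: "'f::field set \<Rightarrow> 'f \<Rightarrow> bool" where
  "separable_over L x \<longleftrightarrow> (\<exists>p. is_min_poly L x p \<and> coprime p (pderiv p))"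

text \<open>Polynomials in indeterminates indexed by the elements of \<open>F\<close> itself are represented, as in
  \<^theory>\<open>HOL-Library.Poly_Mapping\<close>, by finitely supported maps from monomials to coefficients;
  \<open>eval_mpoly\<close> substitutes for each indeterminate its index.\<close>

definition mpolys_over :: "'f::field set \<Rightarrow> 'f set \<Rightarrow> (('f \<Rightarrow>\<^sub>0 nat) \<Rightarrow>\<^sub>0 'f) set" where
  "mpolys_over k B =
     {p. \<forall>m\<in>Poly_Mapping.keys p. Poly_Mapping.lookup p m \<in> k \<and> Poly_Mapping.keys m \<subseteq> B}"

definition eval_mpoly :: "(('f::field \<Rightarrow>\<^sub>0 nat) \<Rightarrow>\<^sub>0 'f) \<Rightarrow> 'f" where
  "eval_mpoly p =
     (\<Sum>m\<in>Poly_Mapping.keys p. Poly_Mapping.lookup p m *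
        (\<Prod>b\<in>Poly_Mapping.keys m. b ^ Poly_Mapping.lookup m b))"

definition algebraically_independent :: "'f::field set \<Rightarrow> 'f set \<Rightarrow> bool" where
  "algebraically_independent k B \<longleftrightarrow> (\<forall>p\<in>mpolys_over k B. eval_mpoly p = 0 \<longrightarrow> p = 0)"

definition transcendence_basis :: "'f::field set \<Rightarrow> 'f set \<Rightarrow> bool" where
  "transcendence_basis k B \<longleftrightarrow>
     algebraically_independent k B \<and> (\<forall>x. algebraic_over (field_adjoin k B) x)"

definition separably_generated :: "'f::field set \<Rightarrow> bool" where
  "separably_generated k \<longleftrightarrow>
     (\<exists>B. transcendence_basis k B \<and> (\<forall>x. separable_over (field_adjoin k B) x))"

text \<open>The transcendence degree of \<open>F/k\<close> is the common cardinality of all transcendence bases.\<close>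

definition infinite_transcendence_degree :: "'f::field set \<Rightarrow> bool" where
  "infinite_transcendence_degree k \<longleftrightarrow> (\<forall>B. transcendence_basis k B \<longrightarrow> infinite B)"

section \<open>Modules over a subring\<close>

text \<open>An \<open>S\<close>-module is a type of class \<open>ab_group_add\<close> with an action of the scalars in \<open>S\<close>; the values
  of \<open>smul r\<close> for \<open>r \<notin> S\<close> are irrelevant and never used.\<close>

definition module_over :: "'f::field set \<Rightarrow> ('f \<Rightarrow> 'm::ab_group_add \<Rightarrow> 'm) \<Rightarrow> bool" where
  "module_over S smul \<longleftrightarrow>
     (\<forall>r\<in>S. \<forall>x y. smul r (x + y) = smul r x + smul r y) \<and>
     (\<forall>r\<in>S. \<forall>s\<in>S. \<forall>x. smul (r + s) x = smul r x + smul s x) \<and>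
     (\<forall>r\<in>S. \<forall>s\<in>S. \<forall>x. smul (r * s) x = smul r (smul s x)) \<and>
     (\<forall>x. smul 1 x = x)"

definition torsion_free :: "'f::field set \<Rightarrow> ('f \<Rightarrow> 'm::ab_group_add \<Rightarrow> 'm) \<Rightarrow> bool" where
  "torsion_free S smul \<longleftrightarrow> (\<forall>r\<in>S. \<forall>x. smul r x = 0 \<longrightarrow> r = 0 \<or> x = 0)"

section \<open>The divisible hull\<close>

text \<open>The divisible hull \<open>FK\<close> is the tensor product of \<open>F\<close> and \<open>K\<close> over \<open>S\<close>: the free abelian group
  on \<open>F \<times> K\<close> modulo the subgroup generated by the usual relations.  Its elements are cosets, so
  their sum is the sum \<open>(+)\<close> of sets from \<^theory>\<open>HOL-Library.Set_Algebras\<close> and the zero element is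
  the subgroup \<open>tensor_relations\<close> itself (not the set \<open>0 = {0}\<close>).\<close>

inductive_set tensor_relators ::
    "'f::field set \<Rightarrow> ('f \<Rightarrow> 'm::ab_group_add \<Rightarrow> 'm) \<Rightarrow> ('f \<times> 'm \<Rightarrow>\<^sub>0 int) set"
  for S :: "'f set" and smul :: "'f \<Rightarrow> 'm \<Rightarrow> 'm"
where
  add_left: "frag_of (a + b, x) - frag_of (a, x) - frag_of (b, x) \<in> tensor_relators S smul"
| add_right: "frag_of (a, x + y) - frag_of (a, x) - frag_of (a, y) \<in> tensor_relators S smul"
| balanced: "s \<in> S \<Longrightarrow> frag_of (a * s, x) - frag_of (a, smul s x) \<in> tensor_relators S smul"

definition tensor_relations ::
    "'f::field set \<Rightarrow> ('f \<Rightarrow> 'm::ab_group_add \<Rightarrow> 'm) \<Rightarrow> ('f \<times> 'm \<Rightarrow>\<^sub>0 int) set" where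
  "tensor_relations S smul = group_closure (tensor_relators S smul)"

definition div_hull ::
    "'f::field set \<Rightarrow> ('f \<Rightarrow> 'm::ab_group_add \<Rightarrow> 'm) \<Rightarrow> ('f \<times> 'm \<Rightarrow>\<^sub>0 int) set set" where
  "div_hull S smul = range (\<lambda>c. c +o tensor_relations S smul)"

definition tensor ::
    "'f::field set \<Rightarrow> ('f \<Rightarrow> 'm::ab_group_add \<Rightarrow> 'm) \<Rightarrow> 'f \<Rightarrow> 'm \<Rightarrow> ('f \<times> 'm \<Rightarrow>\<^sub>0 int) set" where
  "tensor S smul a x = frag_of (a, x) +o tensor_relations S smul"

text \<open>\<open>F\<close> acts through the left factor.\<close>

definition free_scale :: "'f::field \<Rightarrow> ('f \<times> 'm \<Rightarrow>\<^sub>0 int) \<Rightarrow> ('f \<times> 'm \<Rightarrow>\<^sub>0 int)" where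
  "free_scale a = frag_extend (\<lambda>(b, x). frag_of (a * b, x))"

definition hull_scale ::
    "'f::field set \<Rightarrow> ('f \<Rightarrow> 'm::ab_group_add \<Rightarrow> 'm) \<Rightarrow> 'f \<Rightarrow>
     ('f \<times> 'm \<Rightarrow>\<^sub>0 int) set \<Rightarrow> ('f \<times> 'm \<Rightarrow>\<^sub>0 int) set" where
  "hull_scale S smul a A = free_scale a ` A + tensor_relations S smul"

text \<open>The image of \<open>K\<close> in its divisible hull.\<close>

definition hull_base ::
    "'f::field set \<Rightarrow> ('f \<Rightarrow> 'm::ab_group_add \<Rightarrow> 'm) \<Rightarrow> ('f \<times> 'm \<Rightarrow>\<^sub>0 int) set set" where
  "hull_base S smul = range (tensor S smul 1)"

text \<open>The next lemmas confirm that addition and scalar multiplication act on cosets through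
  arbitrary representatives.\<close>

lemma tensor_relations_plus:
  "tensor_relations S smul + tensor_relations S smul = tensor_relations S smul"
proof -
  have "x \<in> tensor_relations S smul + tensor_relations S smul"
    if "x \<in> tensor_relations S smul" for x
    using set_plus_intro[OF that, of 0 "tensor_relations S smul"]
    by (simp add: tensor_relations_def)
  then show ?thesis
    by (auto simp: tensor_relations_def elim!: set_plus_elim intro: group_closure_add)
qed

lemma coset_add:
  "(c +o tensor_relations S smul) + (d +o tensor_relations S smul) =
     (c + d) +o tensor_relations S smul"
  by (simp add: set_plus_rearrange tensor_relations_plus)

lemma free_scale_add: "free_scale a (c + d) = free_scale a c + free_scale a d"
  by (simp add: free_scale_def frag_extend_add)

lemma free_scale_diff: "free_scale a (c - d) = free_scale a c - free_scale a d"
  by (simp add: free_scale_def frag_extend_diff)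

lemma free_scale_of: "free_scale a (frag_of (b, x)) = frag_of (a * b, x)"
  by (simp add: free_scale_def)

lemma free_scale_relations:
  assumes "c \<in> tensor_relations S smul"
  shows "free_scale a c \<in> tensor_relations S smul"
  using assms unfolding tensor_relations_def
proof (induction rule: group_closure.induct)
  case (base c)
  show ?case
  proof (cases "c = 0")
    case False
    with base have "c \<in> tensor_relators S smul"
      by simp
    then have "free_scale a c \<in> tensor_relators S smul"
      by cases (auto simp: free_scale_diff free_scale_of distrib_left mult.assoc[symmetric]
          intro: tensor_relators.intros)
    then show ?thesis
      by (blast intro: group_closure.base)
  qed (simp add: free_scale_def)
next
  case (diff c d)
  then show ?case
    by (simp add: free_scale_diff group_closure.diff)
qed

lemma hull_scale_coset:
  "hull_scale S smul a (c +o tensor_relations S smul) =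
     free_scale a c +o tensor_relations S smul"
  (is "?L = ?R")
proof
  show "?L \<subseteq> ?R"
  proof
    fix y assume "y \<in> ?L"
    then obtain n n' where n: "n \<in> tensor_relations S smul" "n' \<in> tensor_relations S smul"
      and y: "y = free_scale a (c + n) + n'"
      by (auto simp: hull_scale_def elt_set_plus_def set_plus_def)
    have "free_scale a n + n' \<in> tensor_relations S smul"
      using n free_scale_relations[OF n(1), of a]
      by (simp add: tensor_relations_def group_closure_add)
    then show "y \<in> ?R"
      unfolding y by (auto simp: free_scale_add elt_set_plus_def add.assoc)
  qed
  show "?R \<subseteq> ?L"
  proof
    fix y assume "y \<in> ?R"
    then obtain n where n: "n \<in> tensor_relations S smul" "y = free_scale a c + n"
      by (auto simp: elt_set_plus_def)
    moreover have "c \<in> c +o tensor_relations S smul"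
      by (auto simp: elt_set_plus_def tensor_relations_def)
    ultimately show "y \<in> ?L"
      by (auto simp: hull_scale_def)
  qed
qed

section \<open>Rank\<close>

definition hull_subspace ::
    "'f::field set \<Rightarrow> ('f \<Rightarrow> 'm::ab_group_add \<Rightarrow> 'm) \<Rightarrow> ('f \<times> 'm \<Rightarrow>\<^sub>0 int) set set \<Rightarrow> bool" where
  "hull_subspace S smul W \<longleftrightarrow>
     W \<subseteq> div_hull S smul \<and> tensor_relations S smul \<in> W \<and>
     (\<forall>A\<in>W. \<forall>B\<in>W. A + B \<in> W) \<and> (\<forall>a. \<forall>A\<in>W. hull_scale S smul a A \<in> W)"

definition hull_span ::
    "'f::field set \<Rightarrow> ('f \<Rightarrow> 'm::ab_group_add \<Rightarrow> 'm) \<Rightarrow> ('f \<times> 'm \<Rightarrow>\<^sub>0 int) set set \<Rightarrow>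
     ('f \<times> 'm \<Rightarrow>\<^sub>0 int) set set" where
  "hull_span S smul X = \<Inter>{W. hull_subspace S smul W \<and> X \<subseteq> W}"

definition hull_basis ::
    "'f::field set \<Rightarrow> ('f \<Rightarrow> 'm::ab_group_add \<Rightarrow> 'm) \<Rightarrow> ('f \<times> 'm \<Rightarrow>\<^sub>0 int) set set \<Rightarrow> bool" where
  "hull_basis S smul X \<longleftrightarrow>
     X \<subseteq> div_hull S smul \<and> (\<forall>A\<in>X. A \<notin> hull_span S smul (X - {A})) \<and>
     hull_span S smul X = div_hull S smul"

text \<open>The rank of \<open>K\<close> is the dimension over \<open>F\<close> of its divisible hull.\<close>

definition countable_rank :: "'f::field set \<Rightarrow> ('f \<Rightarrow> 'm::ab_group_add \<Rightarrow> 'm) \<Rightarrow> bool" where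
  "countable_rank S smul \<longleftrightarrow> (\<exists>X. hull_basis S smul X \<and> countable X)"

section \<open>Derivations and strongly twisted subrings\<close>

definition hull_derivation ::
    "'f::field set \<Rightarrow> ('f \<Rightarrow> 'm::ab_group_add \<Rightarrow> 'm) \<Rightarrow>
     ('f \<Rightarrow> ('f \<times> 'm \<Rightarrow>\<^sub>0 int) set) \<Rightarrow> bool" where
  "hull_derivation S smul D \<longleftrightarrow>
     range D \<subseteq> div_hull S smul \<and>
     (\<forall>f g. D (f + g) = D f + D g) \<and>
     (\<forall>f g. D (f * g) = hull_scale S smul f (D g) + hull_scale S smul g (D f))"

definition hull_kernel ::
    "'f::field set \<Rightarrow> ('f \<Rightarrow> 'm::ab_group_add \<Rightarrow> 'm) \<Rightarrow>
     ('f \<Rightarrow> ('f \<times> 'm \<Rightarrow>\<^sub>0 int) set) \<Rightarrow> 'f set" where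
  "hull_kernel S smul D = {f. D f = tensor_relations S smul}"

definition strongly_twisted ::
    "'f::field set \<Rightarrow> ('f \<Rightarrow> 'm::ab_group_add \<Rightarrow> 'm) \<Rightarrow> 'f set \<Rightarrow> bool" where
  "strongly_twisted S smul R \<longleftrightarrow>
     is_subring R \<and> R \<subseteq> S \<and>
     (\<exists>D. hull_derivation S smul D \<and>
        R = S \<inter> D -` hull_base S smul \<and>
        hull_span S smul (range D) = div_hull S smul \<and>
        (\<forall>s\<in>S - {0}. S \<subseteq> hull_kernel S smul D + s *o S))"

end

theory Submission
  imports Defs
begin

text \<open>Since \<open>p\<close>-th powers are constants of every derivation \<open>D\<close> in characteristic \<open>p\<close>, condition (c)
  follows from \<open>F = S + Ker D\<close>: writing \<open>t / s\<^sup>p = r + z\<close> with \<open>r \<in> S\<close> and \<open>D z = 0\<close> gives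
  \<open>t = s\<^sup>p z + s\<^sup>p r\<close>.

  Let \<open>B\<close> be a separating transcendence basis.  The partial derivatives \<open>\<partial>/\<partial>b\<close> extend to \<open>F\<close> by
  separability, and for each element of \<open>F\<close> only finitely many of them do not vanish, so a derivation
  may be prescribed freely on \<open>B\<close>.  As \<open>k\<close> is countable, \<open>F\<close> has the same cardinality as \<open>B\<close>.  Hence
  \<open>B\<close> can be split into layers indexed by \<open>nat\<close> such that every element of \<open>F\<close> is attached to some
  \<open>b\<close> in each layer.  The bottom layer takes the vectors of a countable spanning set of \<open>FK\<close> as
  values; higher up, \<open>D b\<close> is chosen so that a multiple of \<open>b\<close> in \<open>S\<close> by a \<open>p\<close>-th power has the same
  derivative as the attached element \<open>f\<close>.  This determines \<open>D\<close> without circularity because \<open>f\<close>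
  involves only finitely many layers and is attached to some \<open>b\<close> above all of them.\<close>

section \<open>Dual numbers\<close>

text \<open>The ring \<open>F[e]\<close> with \<open>e * e = 0\<close>. A map \<open>D\<close> is a
  derivation exactly when sending \<open>x\<close> to \<open>Dual x (D x)\<close> is a ring
  homomorphism, so extending derivations becomes enlarging subrings.\<close>

datatype 'a dual = Dual (re: 'a) (eps: 'a)

instantiation dual :: (comm_ring_1) comm_ring_1
begin

definition "0 = Dual 0 0"
definition "1 = Dual 1 0"
definition "x + y = Dual (re x + re y) (eps x + eps y)"
definition "x - y = Dual (re x - re y) (eps x - eps y)"
definition "- x = Dual (- re x) (- eps x)"
definition "x * y = Dual (re x * re y) (re x * eps y + re y * eps x)"

instance
  by standard (auto simp: zero_dual_def one_dual_def plus_dual_def minus_dual_def uminus_dual_def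
      times_dual_def algebra_simps)

end

lemma re_simps [simp]:
  "re (0 :: 'a::comm_ring_1 dual) = 0" "re (1 :: 'a::comm_ring_1 dual) = 1"
  "re (x + y) = re x + re y" "re (x - y) = re x - re y" "re (- x) = - re x"
  "re (x * y) = re x * re y"
  for x y :: "'a::comm_ring_1 dual"
  by (simp_all add: zero_dual_def one_dual_def plus_dual_def minus_dual_def uminus_dual_def
      times_dual_def)

lemma eps_simps [simp]:
  "eps (0 :: 'a::comm_ring_1 dual) = 0" "eps (1 :: 'a::comm_ring_1 dual) = 0"
  "eps (x + y) = eps x + eps y" "eps (x - y) = eps x - eps y" "eps (- x) = - eps x"
  "eps (x * y) = re x * eps y + re y * eps x"
  for x y :: "'a::comm_ring_1 dual"
  by (simp_all add: zero_dual_def one_dual_def plus_dual_def minus_dual_def uminus_dual_def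
      times_dual_def)

lemma re_sum: "re (\<Sum>i\<in>A. f i) = (\<Sum>i\<in>A. re (f i :: 'a::comm_ring_1 dual))"
  by (induction A rule: infinite_finite_induct) auto

lemma re_prod: "re (\<Prod>i\<in>A. f i) = (\<Prod>i\<in>A. re (f i :: 'a::comm_ring_1 dual))"
  by (induction A rule: infinite_finite_induct) auto

lemma re_power: "re (x ^ n) = re (x :: 'a::comm_ring_1 dual) ^ n"
  by (induction n) auto

lemma map_poly_re_mult:
  "map_poly re (p * q) = map_poly re p * map_poly re (q :: 'a::comm_ring_1 dual poly)"
  by (rule poly_eqI) (simp add: coeff_map_poly coeff_mult re_sum)

lemma map_poly_re_diff:
  "map_poly re (p - q) = map_poly re p - map_poly re (q :: 'a::comm_ring_1 dual poly)"
  by (rule poly_eqI) (simp add: coeff_map_poly)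

lemma re_poly: "re (poly p z) = poly (map_poly re p) (re z)"
  for p :: "'a::comm_ring_1 dual poly"
  by (induction p) (auto simp: map_poly_pCons)

text \<open>First-order Taylor expansion at \<open>x\<close>, exact because the square of the
  infinitesimal part is zero. It turns the search for a root above \<open>x\<close> into a linear
  equation for \<open>u\<close>.\<close>

lemma eps_poly_Dual:
  "eps (poly p (Dual x u)) = eps (poly p (Dual x 0)) + u * poly (pderiv (map_poly re p)) x"
  for p :: "'a::idom dual poly"
proof (induction p)
  case (pCons c p)
  then show ?case
    by (simp add: map_poly_pCons re_poly pderiv_pCons distrib_left ac_simps)
qed simp

section \<open>Subrings and polynomials over them\<close>

text \<open>Stated for all commutative rings with 1, since it is applied to dual numbers and to
  polynomial rings, which are not fields.\<close>

definition ring_closed :: "'a::comm_ring_1 set \<Rightarrow> bool" where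
  "ring_closed H \<longleftrightarrow> 1 \<in> H \<and> (\<forall>x\<in>H. \<forall>y\<in>H. x - y \<in> H \<and> x * y \<in> H)"

lemma ring_closedD:
  assumes "ring_closed H"
  shows "1 \<in> H" "0 \<in> H" "x \<in> H \<Longrightarrow> y \<in> H \<Longrightarrow> x - y \<in> H" "x \<in> H \<Longrightarrow> y \<in> H \<Longrightarrow> x * y \<in> H"
    "x \<in> H \<Longrightarrow> y \<in> H \<Longrightarrow> x + y \<in> H" "x \<in> H \<Longrightarrow> - x \<in> H" "x \<in> H \<Longrightarrow> x ^ n \<in> H"
    "(\<And>i. i \<in> A \<Longrightarrow> f i \<in> H) \<Longrightarrow> sum f A \<in> H"
proof -
  show one: "1 \<in> H" and diff: "\<And>x y. x \<in> H \<Longrightarrow> y \<in> H \<Longrightarrow> x - y \<in> H"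
    and mult: "\<And>x y. x \<in> H \<Longrightarrow> y \<in> H \<Longrightarrow> x * y \<in> H"
    using assms by (auto simp: ring_closed_def)
  show zero: "0 \<in> H" using diff[OF one one] by simp
  show uminus: "- x \<in> H" if "x \<in> H" for x using diff[OF zero that] by simp
  show add: "x + y \<in> H" if "x \<in> H" "y \<in> H" for x y
    using diff[OF that(1) uminus[OF that(2)]] by simp
  show "x ^ n \<in> H" if "x \<in> H" by (induction n) (auto simp: that one mult)
  show "sum f A \<in> H" if "\<And>i. i \<in> A \<Longrightarrow> f i \<in> H"
    using that by (induction A rule: infinite_finite_induct) (auto simp: zero add)
qed

lemma is_subring_iff: "is_subring H \<longleftrightarrow> ring_closed H"
  by (simp add: is_subring_def ring_closed_def)

definition polys_in :: "'a::comm_ring_1 set \<Rightarrow> 'a poly set" where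
  "polys_in H = {q. \<forall>i. coeff q i \<in> H}"

lemma polys_over_eq:
  assumes "ring_closed H"
  shows "polys_over H = polys_in H"
proof -
  have "p \<in> polys_over H \<longleftrightarrow> range (coeff p) \<subseteq> H" for p
    using ring_closedD(2)[OF assms] by (simp add: polys_over_def range_coeff)
  then show ?thesis
    by (auto simp: polys_in_def)
qed

lemma ring_closed_polys_in:
  assumes "ring_closed H"
  shows "ring_closed (polys_in H)"
  unfolding ring_closed_def polys_in_def
  using ring_closedD(1-4)[OF assms]
  by (auto simp: coeff_mult intro!: ring_closedD(8)[OF assms])

lemma pCons_in_polys_in: "ring_closed H \<Longrightarrow> pCons c p \<in> polys_in H \<longleftrightarrow> c \<in> H \<and> p \<in> polys_in H"
  by (auto simp: polys_in_def coeff_pCons split: nat.splits)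

lemma const_in_polys_in: "ring_closed H \<Longrightarrow> c \<in> H \<Longrightarrow> [:c:] \<in> polys_in H"
  using ring_closedD(2)[of H] by (auto simp: polys_in_def coeff_pCons split: nat.splits)

lemma monom_in_polys_in: "ring_closed H \<Longrightarrow> c \<in> H \<Longrightarrow> monom c n \<in> polys_in H"
  using ring_closedD(2)[of H] by (auto simp: polys_in_def)

lemma ring_closed_adjoin:
  assumes "ring_closed H"
  shows "ring_closed ((\<lambda>q. poly q z) ` polys_in H)" "H \<subseteq> (\<lambda>q. poly q z) ` polys_in H"
    "z \<in> (\<lambda>q. poly q z) ` polys_in H"
proof -
  note P = ring_closedD[OF ring_closed_polys_in[OF assms]]
  show "ring_closed ((\<lambda>q. poly q z) ` polys_in H)"
    unfolding ring_closed_def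
  proof (intro conjI ballI)
    show "1 \<in> (\<lambda>q. poly q z) ` polys_in H"
      using P(1) by (intro rev_image_eqI[of 1]) auto
    fix x y assume "x \<in> (\<lambda>q. poly q z) ` polys_in H" "y \<in> (\<lambda>q. poly q z) ` polys_in H"
    then obtain p q where "p \<in> polys_in H" "x = poly p z" "q \<in> polys_in H" "y = poly q z" by auto
    then show "x - y \<in> (\<lambda>q. poly q z) ` polys_in H" "x * y \<in> (\<lambda>q. poly q z) ` polys_in H"
      using P(3,4)[of p q] by (auto intro: rev_image_eqI[of "p - q"] rev_image_eqI[of "p * q"])
  qed
  show "H \<subseteq> (\<lambda>q. poly q z) ` polys_in H"
    using const_in_polys_in[OF assms] by (force simp: image_iff)
  have "[:0, 1:] \<in> polys_in H"
    using ring_closedD(1,2)[OF assms] P(2) by (simp add: pCons_in_polys_in assms)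
  then show "z \<in> (\<lambda>q. poly q z) ` polys_in H"
    by (force simp: image_iff)
qed

text \<open>Long division by a polynomial of least degree; the quotient stays over \<open>L\<close>
  because leading coefficients are inverted in \<open>L\<close>.\<close>

lemma minimal_generator:
  fixes L :: "'f::field set"
  assumes L: "ring_closed L" and inv: "\<And>c. c \<in> L \<Longrightarrow> inverse c \<in> L"
    and f: "f \<in> polys_in L" "f \<noteq> 0" "poly f x = 0"
  obtains g where "g \<in> polys_in L" "poly g x = 0"
    "\<And>h. h \<in> polys_in L \<Longrightarrow> poly h x = 0 \<Longrightarrow> \<exists>q\<in>polys_in L. h = q * g"
proof -
  define P where "P g \<longleftrightarrow> g \<in> polys_in L \<and> g \<noteq> 0 \<and> poly g x = 0" for g
  obtain g where g: "P g" and min: "\<And>h. P h \<Longrightarrow> Polynomial.degree g \<le> Polynomial.degree h"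
    using ex_has_least_nat[of P f Polynomial.degree] f by (auto simp: P_def)
  note PL = ring_closedD[OF ring_closed_polys_in[OF L]]
  have "\<exists>q\<in>polys_in L. h = q * g" if "h \<in> polys_in L" "poly h x = 0" for h
    using that
  proof (induction "Polynomial.degree h" arbitrary: h rule: less_induct)
    case less
    show ?case
    proof (cases "h = 0")
      case True
      then show ?thesis using PL(2) by (intro bexI[of _ 0]) auto
    next
      case False
      then have deg: "Polynomial.degree g \<le> Polynomial.degree h"
        using min less by (auto simp: P_def)
      \<comment> \<open>The monomial whose product with \<open>g\<close> cancels the leading term of
        \<open>h\<close>.\<close>
      define m where "m = monom (lead_coeff h * inverse (lead_coeff g))
        (Polynomial.degree h - Polynomial.degree g)"
      have m: "m \<in> polys_in L"
        using less(2) g unfolding m_def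
        by (intro monom_in_polys_in L ring_closedD(4)[OF L] inv) (auto simp: polys_in_def P_def)
      define h' where "h' = h - m * g"
      have h': "h' \<in> polys_in L" "poly h' x = 0"
        using PL(3,4) m less(2,3) g by (auto simp: h'_def P_def)
      have g0: "g \<noteq> 0" "lead_coeff g \<noteq> 0"
        using g by (auto simp: P_def)
      have lc: "lead_coeff h * inverse (lead_coeff g) \<noteq> 0"
        using False g0 by simp
      have dm: "Polynomial.degree (m * g) = Polynomial.degree h"
        using lc g0 deg by (subst degree_mult_eq) (auto simp: m_def degree_monom_eq)
      have cm: "lead_coeff (m * g) = lead_coeff h"
        using lc g0 by (simp add: lead_coeff_mult m_def degree_monom_eq)
      show ?thesis
      proof (cases "h' = 0")
        case True
        then show ?thesis using m by (auto simp: h'_def)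
      next
        case nz: False
        have "coeff h' (Polynomial.degree h) = 0"
          using cm dm by (simp add: h'_def)
        moreover have "Polynomial.degree h' \<le> Polynomial.degree h"
          unfolding h'_def using degree_diff_le_max[of h "m * g"] dm by simp
        ultimately have "Polynomial.degree h' < Polynomial.degree h"
          using nz by (metis le_neq_implies_less leading_coeff_0_iff)
        from less(1)[OF this h'] obtain q where "q \<in> polys_in L" "h' = q * g" by auto
        then have "h = (q + m) * g" "q + m \<in> polys_in L"
          using PL(5) m by (auto simp: h'_def algebra_simps)
        then show ?thesis by blast
      qed
    qed
  qed
  with g show thesis by (intro that[of g]) (auto simp: P_def)
qed

section \<open>Extension of derivations\<close>

definition is_derivation :: "('a::comm_ring_1 \<Rightarrow> 'a) \<Rightarrow> bool" where
  "is_derivation D \<longleftrightarrow> (\<forall>x y. D (x + y) = D x + D y) \<and> (\<forall>x y. D (x * y) = x * D y + y * D x)"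

text \<open>Such an \<open>H\<close> is the graph of a derivation from the subring \<open>re ` H\<close> to \<open>F\<close>.\<close>

definition derivation_graph :: "'a::comm_ring_1 dual set \<Rightarrow> bool" where
  "derivation_graph H \<longleftrightarrow> ring_closed H \<and> (\<forall>h\<in>H. re h = 0 \<longrightarrow> h = 0)"

lemma derivation_graph_inj:
  assumes "derivation_graph H" "g \<in> H" "h \<in> H" "re g = re h"
  shows "g = h"
  using assms ring_closedD(3)[of H g h] unfolding derivation_graph_def
  by (metis eq_iff_diff_eq_0 re_simps(4))

text \<open>Zorn's lemma: two elements of the union of a chain lie in a common member, so the union
  is again a graph.\<close>

lemma maximal_derivation_graph:
  assumes "derivation_graph H0"
  obtains H where "derivation_graph H" "H0 \<subseteq> H"
    "\<And>G. derivation_graph G \<Longrightarrow> H \<subseteq> G \<Longrightarrow> G = H"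
proof -
  let ?A = "{H. derivation_graph H \<and> H0 \<subseteq> H}"
  have "\<exists>M\<in>?A. \<forall>X\<in>?A. M \<subseteq> X \<longrightarrow> X = M"
  proof (rule subset_Zorn_nonempty)
    show "?A \<noteq> {}" using assms by auto
    fix C assume C: "C \<noteq> {}" "subset.chain ?A C"
    then have gr: "\<And>H. H \<in> C \<Longrightarrow> derivation_graph H \<and> H0 \<subseteq> H"
      by (auto simp: subset_chain_def)
    have "ring_closed (\<Union>C)"
      unfolding ring_closed_def
    proof (intro conjI ballI)
      show "1 \<in> \<Union>C" using C gr by (auto simp: derivation_graph_def ring_closed_def)
      fix x y assume "x \<in> \<Union>C" "y \<in> \<Union>C"
      then obtain H where "H \<in> C" "x \<in> H" "y \<in> H"
        using C(2) unfolding subset_chain_def by blast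
      then show "x - y \<in> \<Union>C" "x * y \<in> \<Union>C"
        using gr[of H] by (auto simp: derivation_graph_def ring_closed_def)
    qed
    then show "\<Union>C \<in> ?A"
      using C gr by (auto simp: derivation_graph_def)
  qed
  then obtain M where "M \<in> ?A" "\<forall>X\<in>?A. M \<subseteq> X \<longrightarrow> X = M" by blast
  then show thesis by (intro that[of M]) blast+
qed

text \<open>Adjoining the inverse of an \<open>h\<close> above \<open>x\<close> keeps the graph
  condition, since a power of \<open>h\<close> clears all denominators; by maximality the inverse is
  already there.\<close>

lemma maximal_derivation_graph_inverse:
  fixes H :: "'f::field dual set"
  assumes H: "derivation_graph H"
    and max: "\<And>G. derivation_graph G \<Longrightarrow> H \<subseteq> G \<Longrightarrow> G = H"
    and x: "x \<in> re ` H"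
  shows "inverse x \<in> re ` H"
proof (cases "x = 0")
  case False
  obtain h where h: "h \<in> H" "re h = x" using x by auto
  \<comment> \<open>The quotient rule dictates the infinitesimal part.\<close>
  define i where "i = Dual (inverse x) (- eps h * inverse x * inverse x)"
  have i: "h * i = 1"
    using h False by (auto simp: i_def times_dual_def one_dual_def field_simps)
  have R: "ring_closed H" using H by (simp add: derivation_graph_def)
  note R = R ring_closedD[OF R]
  define G where "G = (\<lambda>q. poly q i) ` polys_in H"
  have "derivation_graph G"
    unfolding derivation_graph_def
  proof (intro conjI ballI impI)
    show "ring_closed G" unfolding G_def by (rule ring_closed_adjoin[OF R(1)])
    fix g assume "g \<in> G" and g0: "re g = 0"
    then obtain q where q: "q \<in> polys_in H" "g = poly q i" by (auto simp: G_def)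
    have clear: "\<exists>n. h ^ n * poly q i \<in> H"
      using q(1)
    proof (induction q)
      case 0
      then show ?case using R(3) by simp
    next
      case (pCons c q)
      then obtain n where n: "h ^ n * poly q i \<in> H"
        by (auto simp: pCons_in_polys_in R(1))
      have "h ^ Suc n * poly (pCons c q) i = h ^ Suc n * c + (h * i) * (h ^ n * poly q i)"
        by (simp add: algebra_simps)
      also have "\<dots> \<in> H"
        using n pCons.prems h R(5,6,8) unfolding i by (simp add: pCons_in_polys_in R(1))
      finally show ?case by blast
    qed
    then obtain n where "h ^ n * g \<in> H" using q by auto
    moreover have "re (h ^ n * g) = 0" using g0 by simp
    ultimately have "h ^ n * g = 0" using H by (auto simp: derivation_graph_def)
    then have "i ^ n * (h ^ n * g) = 0" by simp
    then have "(h * i) ^ n * g = 0" by (simp add: power_mult_distrib ac_simps)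
    then show "g = 0" by (simp add: i)
  qed
  moreover have "H \<subseteq> G" "i \<in> G" unfolding G_def using ring_closed_adjoin[OF R(1)] by auto
  ultimately have "i \<in> H" using max by blast
  moreover have "re i = inverse x" by (simp add: i_def)
  ultimately show ?thesis by (metis imageI)
\<comment> \<open>The case \<open>x = 0\<close> rests on \<open>inverse 0 = 0\<close>.\<close>
qed (use H ring_closedD(2)[of H] in \<open>force simp: derivation_graph_def\<close>)

text \<open>A derivation extends to a simple separable extension: differentiating the equation
  \<open>g x = 0\<close> for the minimal polynomial determines the value at \<open>x\<close>.
  Maximality then puts \<open>x\<close> into the domain.\<close>

lemma maximal_derivation_graph_separable:
  fixes H :: "'f::field dual set"
  assumes H: "derivation_graph H"
    and max: "\<And>G. derivation_graph G \<Longrightarrow> H \<subseteq> G \<Longrightarrow> G = H"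
    and f: "f \<in> polys_in (re ` H)" "poly f x = 0" "poly (pderiv f) x \<noteq> 0"
  shows "x \<in> re ` H"
proof -
  have R: "ring_closed H" using H by (simp add: derivation_graph_def)
  note R = R ring_closedD[OF R]
  define L where "L = re ` H"
  have L: "ring_closed L"
    unfolding ring_closed_def L_def
  proof (intro conjI ballI)
    show "1 \<in> re ` H" using R(2) by force
    fix x y assume "x \<in> re ` H" "y \<in> re ` H"
    then obtain a b where "a \<in> H" "x = re a" "b \<in> H" "y = re b" by auto
    then show "x - y \<in> re ` H" "x * y \<in> re ` H"
      using R(4,5)[of a b] by (auto intro: rev_image_eqI[of "a - b"] rev_image_eqI[of "a * b"])
  qed
  have lift: "\<exists>p\<in>polys_in H. map_poly re p = q" if "q \<in> polys_in L" for q
    using that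
  proof (induction q)
    case 0
    then show ?case using ring_closedD(2)[OF ring_closed_polys_in[OF R(1)]] by force
  next
    case (pCons c q)
    then obtain p where "p \<in> polys_in H" "map_poly re p = q"
      by (auto simp: pCons_in_polys_in L)
    moreover obtain d where "d \<in> H" "re d = c"
      using pCons.prems by (auto simp: pCons_in_polys_in L) (auto simp: L_def)
    ultimately show ?case
      by (intro bexI[of _ "pCons d p"]) (auto simp: pCons_in_polys_in R(1) map_poly_pCons)
  qed
  have "f \<noteq> 0" using f by auto
  moreover have "inverse c \<in> L" if "c \<in> L" for c
    using maximal_derivation_graph_inverse[OF H max] that unfolding L_def by blast
  moreover have "f \<in> polys_in L" using f(1) by (simp add: L_def)
  ultimately obtain g where g: "g \<in> polys_in L" "poly g x = 0"
    and gen: "\<And>h. h \<in> polys_in L \<Longrightarrow> poly h x = 0 \<Longrightarrow> \<exists>q\<in>polys_in L. h = q * g"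
    using minimal_generator[OF L _ _ _ f(2)] by metis
  obtain q where q: "f = q * g" using gen[of f] f(1,2) unfolding L_def by blast
  \<comment> \<open>At the root \<open>x\<close> of \<open>g\<close>, the product rule for
    \<open>f = q * g\<close> leaves only \<open>q x * g' x\<close>, so the derivative of
    \<open>g\<close> cannot vanish there.\<close>
  have g': "poly (pderiv g) x \<noteq> 0"
    using f(3) g(2) unfolding q by (auto simp: pderiv_mult)
  obtain g1 where g1: "g1 \<in> polys_in H" "map_poly re g1 = g"
    using lift[OF g(1)] by blast
  \<comment> \<open>Solves the linear equation of \<open>eps_poly_Dual\<close>, so that
    \<open>g1\<close> vanishes at \<open>z\<close>.\<close>
  define u where "u = - eps (poly g1 (Dual x 0)) / poly (pderiv g) x"
  define z where "z = Dual x u"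
  have "re (poly g1 z) = 0"
    by (simp add: z_def re_poly g1(2) g(2))
  moreover have "eps (poly g1 z) = 0"
    unfolding z_def eps_poly_Dual[of g1 x u] using g' by (simp add: u_def g1(2))
  ultimately have g1z: "poly g1 z = 0"
    by (intro dual.expand) simp
  define G where "G = (\<lambda>q. poly q z) ` polys_in H"
  note PH = ring_closedD[OF ring_closed_polys_in[OF R(1)]]
  have "derivation_graph G"
    unfolding derivation_graph_def
  proof (intro conjI ballI impI)
    show "ring_closed G" unfolding G_def by (rule ring_closed_adjoin[OF R(1)])
    fix y assume "y \<in> G" and y0: "re y = 0"
    then obtain h where h: "h \<in> polys_in H" "y = poly h z" by (auto simp: G_def)
    have "map_poly re h \<in> polys_in L"
      using h by (auto simp: polys_in_def coeff_map_poly L_def)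
    moreover have "poly (map_poly re h) x = 0"
      using h y0 by (simp add: re_poly z_def)
    ultimately obtain q where "q \<in> polys_in L" and q: "map_poly re h = q * g"
      using gen by blast
    then obtain q1 where q1: "q1 \<in> polys_in H" "map_poly re q1 = q"
      using lift by blast
    \<comment> \<open>The coefficients of this difference lie in \<open>H\<close> and have real part
      0, so they vanish: \<open>h\<close> is a multiple of \<open>g1\<close>, which has the root
      \<open>z\<close>.\<close>
    have "h - q1 * g1 \<in> polys_in H" using h(1) q1(1) g1(1) PH(3,4) by blast
    moreover have "map_poly re (h - q1 * g1) = 0"
      by (simp add: map_poly_re_diff map_poly_re_mult q q1 g1)
    then have "\<And>i. re (coeff (h - q1 * g1) i) = 0"
      by (metis coeff_0 coeff_map_poly re_simps(1))
    moreover have "c = 0" if "c \<in> H" "re c = 0" for c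
      using H that by (simp add: derivation_graph_def)
    ultimately have "coeff (h - q1 * g1) i = 0" for i
      by (simp only: polys_in_def mem_Collect_eq)
    then have "h - q1 * g1 = 0"
      by (intro poly_eqI) (simp only: coeff_0)
    then show "y = 0" using h g1z by simp
  qed
  moreover have "H \<subseteq> G" "z \<in> G" unfolding G_def using ring_closed_adjoin[OF R(1)] by auto
  ultimately have "z \<in> H" using max by blast
  then show ?thesis by (metis z_def dual.sel(1) imageI)
qed

section \<open>Partial derivatives with respect to a separating transcendence basis\<close>

lemma is_subfield_field_adjoin: "is_subfield (field_adjoin k B)"
  unfolding field_adjoin_def is_subfield_def is_subring_def by auto

lemma field_adjoin_least:
  "is_subfield L \<Longrightarrow> k \<subseteq> L \<Longrightarrow> B \<subseteq> L \<Longrightarrow> field_adjoin k B \<subseteq> L"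
  unfolding field_adjoin_def by auto

text \<open>A common root of \<open>f\<close> and its derivative would make \<open>X - x\<close> a
  common factor.\<close>

lemma separable_overE:
  assumes "is_subfield L" "separable_over L x"
  obtains f where "f \<in> polys_in L" "poly f x = 0" "poly (pderiv f) x \<noteq> 0"
proof -
  obtain f where f: "f \<in> polys_over L" "poly f x = 0" "coprime f (pderiv f)"
    using assms(2) by (auto simp: separable_over_def is_min_poly_def)
  have "poly (pderiv f) x \<noteq> 0"
  proof
    assume "poly (pderiv f) x = 0"
    then have "[:- x, 1:] dvd f" "[:- x, 1:] dvd pderiv f"
      using f(2) by (simp_all add: poly_eq_0_iff_dvd)
    then have "is_unit [:- x, 1:]"
      using f(3) coprime_common_divisor by blast
    then show False by (simp add: is_unit_iff_degree)
  qed
  moreover have "f \<in> polys_in L"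
    using f(1) assms(1) by (simp add: polys_over_eq is_subfield_def is_subring_iff)
  ultimately show thesis using that f(2) by blast
qed

section \<open>Calculus rules for derivations\<close>

lemma derivation_simps:
  assumes "is_derivation D"
  shows "D (x + y) = D x + D y" "D (x * y) = x * D y + y * D x" "D 0 = 0" "D 1 = 0"
    "D (- x) = - D x" "D (x - y) = D x - D y" "D (x ^ n) = of_nat n * x ^ (n - 1) * D x"
proof -
  show add: "D (x + y) = D x + D y" and mult: "D (x * y) = x * D y + y * D x" for x y
    using assms by (auto simp: is_derivation_def)
  show zero: "D 0 = 0" using add[of 0 0] by simp
  show one: "D 1 = 0" using mult[of 1 1] by simp
  show uminus: "D (- x) = - D x" for x using add[of x "- x"] zero by (simp add: eq_neg_iff_add_eq_0 add.commute)
  show "D (x - y) = D x - D y" using add[of x "- y"] uminus by simp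
  show "D (x ^ n) = of_nat n * x ^ (n - 1) * D x"
  proof (induction n)
    case (Suc n)
    then show ?case by (cases n) (simp_all add: mult one algebra_simps)
  qed (simp add: one)
qed

lemma derivation_inverse:
  fixes D :: "'f::field \<Rightarrow> 'f"
  assumes "is_derivation D"
  shows "D (inverse x) = - D x / (x * x)"
proof (cases "x = 0")
  case True
  then show ?thesis by (simp add: derivation_simps[OF assms])
next
  case False
  have "0 = D (x * inverse x)" using False by (simp add: derivation_simps[OF assms])
  also have "\<dots> = x * D (inverse x) + inverse x * D x" by (simp only: derivation_simps[OF assms])
  finally show ?thesis using False by (simp add: field_simps eq_neg_iff_add_eq_0)
qed

lemma derivation_poly:
  assumes D: "is_derivation D" and "\<And>i. D (coeff q i) = 0"
  shows "D (poly q x) = poly (pderiv q) x * D x"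
  using assms(2)
proof (induction q)
  case (pCons c q)
  have "D c = 0" "\<And>i. D (coeff q i) = 0"
    using pCons.prems[of 0] pCons.prems[of "Suc _"] by simp_all
  then show ?case
    using pCons.IH by (simp add: derivation_simps(1,2)[OF D] pderiv_pCons algebra_simps)
qed (simp add: derivation_simps[OF D])

section \<open>Polynomial expressions in dual numbers and the graph over \<open>k[B]\<close>\<close>

definition mono_val :: "('b \<Rightarrow> 'a::comm_ring_1) \<Rightarrow> ('b \<Rightarrow>\<^sub>0 nat) \<Rightarrow> 'a" where
  "mono_val X m = (\<Prod>b\<in>Poly_Mapping.keys m. X b ^ Poly_Mapping.lookup m b)"

lemma mono_val_superset:
  "finite A \<Longrightarrow> Poly_Mapping.keys m \<subseteq> A \<Longrightarrow> mono_val X m = (\<Prod>b\<in>A. X b ^ Poly_Mapping.lookup m b)"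
  unfolding mono_val_def by (rule prod.mono_neutral_left) (auto simp: in_keys_iff)

lemma mono_val_add: "mono_val X (m + n) = mono_val X m * mono_val X n"
proof -
  let ?A = "Poly_Mapping.keys m \<union> Poly_Mapping.keys n"
  have "Poly_Mapping.keys (m + n) \<subseteq> ?A" by (rule Poly_Mapping.keys_add)
  then show ?thesis
    by (simp add: mono_val_superset[of ?A] lookup_add power_add prod.distrib)
qed

lemma mono_val_0 [simp]: "mono_val X 0 = 1"
  by (simp add: mono_val_def)

lemma mono_val_single [simp]: "mono_val X (Poly_Mapping.single b (Suc 0)) = X b"
  by (simp add: mono_val_def)

text \<open>For algebraically independent \<open>B\<close> this is the graph over
  \<open>k[B]\<close> of the derivation that is 0 on \<open>k\<close> and \<open>d b\<close> at
  \<open>b\<close>: evaluating at \<open>Dual b (d b)\<close> carries out the product rule.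
  Arbitrary finite \<open>M\<close>, with zero coefficients allowed, lets two sums be brought to a
  common index set.\<close>

definition poly_expressions ::
    "'f::field set \<Rightarrow> 'f set \<Rightarrow> ('f \<Rightarrow> 'f) \<Rightarrow> 'f dual set" where
  "poly_expressions k B d =
     {\<Sum>m\<in>M. Dual (c m) 0 * mono_val (\<lambda>b. Dual b (d b)) m | M c.
        finite M \<and> (\<forall>m\<in>M. c m \<in> k \<and> Poly_Mapping.keys m \<subseteq> B)}"

lemma poly_expressions_term:
  "c \<in> k \<Longrightarrow> Poly_Mapping.keys m \<subseteq> B \<Longrightarrow>
     Dual c 0 * mono_val (\<lambda>b. Dual b (d b)) m \<in> poly_expressions k B d"
  unfolding poly_expressions_def
  by (rule CollectI, rule exI[of _ "{m}"], rule exI[of _ "\<lambda>_. c"]) auto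

lemma poly_expressions_add:
  assumes k: "ring_closed k" and "g \<in> poly_expressions k B d" "h \<in> poly_expressions k B d"
  shows "g + h \<in> poly_expressions k B d"
proof -
  let ?v = "mono_val (\<lambda>b. Dual b (d b))"
  obtain M c where M: "finite M" "\<And>m. m \<in> M \<Longrightarrow> c m \<in> k \<and> Poly_Mapping.keys m \<subseteq> B"
    and g: "g = (\<Sum>m\<in>M. Dual (c m) 0 * ?v m)"
    using assms(2) by (auto simp: poly_expressions_def)
  obtain N e where N: "finite N" "\<And>m. m \<in> N \<Longrightarrow> e m \<in> k \<and> Poly_Mapping.keys m \<subseteq> B"
    and h: "h = (\<Sum>m\<in>N. Dual (e m) 0 * ?v m)"
    using assms(3) by (auto simp: poly_expressions_def)
  define c' where "c' m = (if m \<in> M then c m else 0)" for m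
  define e' where "e' m = (if m \<in> N then e m else 0)" for m
  have z: "Dual 0 0 = (0 :: 'a dual)" by (simp add: zero_dual_def)
  have "g = (\<Sum>m\<in>M \<union> N. Dual (c' m) 0 * ?v m)"
    unfolding g using M(1) N(1) by (intro sum.mono_neutral_cong_left) (auto simp: c'_def z)
  moreover have "h = (\<Sum>m\<in>M \<union> N. Dual (e' m) 0 * ?v m)"
    unfolding h using M(1) N(1) by (intro sum.mono_neutral_cong_left) (auto simp: e'_def z)
  moreover have "Dual (a + b) 0 = Dual a 0 + Dual b (0 :: 'a)" for a b
    by (simp add: plus_dual_def)
  ultimately have "g + h = (\<Sum>m\<in>M \<union> N. Dual (c' m + e' m) 0 * ?v m)"
    by (simp add: sum.distrib distrib_right)
  moreover have "c' m + e' m \<in> k \<and> Poly_Mapping.keys m \<subseteq> B" if "m \<in> M \<union> N" for m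
    using M(2)[of m] N(2)[of m] that ring_closedD(5)[OF k] by (auto simp: c'_def e'_def)
  ultimately show ?thesis
    unfolding poly_expressions_def using M(1) N(1)
    by (intro CollectI exI[of _ "M \<union> N"] exI[of _ "\<lambda>m. c' m + e' m"]) auto
qed

lemma ring_closed_poly_expressions:
  assumes k: "ring_closed k"
  shows "ring_closed (poly_expressions k B d)"
proof -
  let ?H = "poly_expressions k B d" and ?v = "mono_val (\<lambda>b. Dual b (d b))"
  have one: "1 \<in> ?H"
    using poly_expressions_term[of 1 k 0 B d] ring_closedD(1)[OF k] by (simp flip: one_dual_def)
  have zero: "0 \<in> ?H"
    using poly_expressions_term[of 0 k 0 B d] ring_closedD(2)[OF k] by (simp flip: zero_dual_def)
  have sum: "(\<Sum>i\<in>I. f i) \<in> ?H" if "\<And>i. i \<in> I \<Longrightarrow> f i \<in> ?H" for I :: "'i set" and f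
    using that by (induction I rule: infinite_finite_induct)
      (auto simp: zero poly_expressions_add[OF k])
  have mult: "g * h \<in> ?H" if gh: "g \<in> ?H" "h \<in> ?H" for g h
  proof -
    obtain M c where M: "\<And>m. m \<in> M \<Longrightarrow> c m \<in> k \<and> Poly_Mapping.keys m \<subseteq> B"
      and g: "g = (\<Sum>m\<in>M. Dual (c m) 0 * ?v m)"
      using gh(1) by (auto simp: poly_expressions_def)
    obtain N e where N: "\<And>m. m \<in> N \<Longrightarrow> e m \<in> k \<and> Poly_Mapping.keys m \<subseteq> B"
      and h: "h = (\<Sum>m\<in>N. Dual (e m) 0 * ?v m)"
      using gh(2) by (auto simp: poly_expressions_def)
    have "Dual (c m) 0 * ?v m * (Dual (e n) 0 * ?v n) \<in> ?H" if "m \<in> M" "n \<in> N" for m n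
    proof -
      have "Dual (c m * e n) 0 = Dual (c m) 0 * Dual (e n) 0"
        by (simp add: times_dual_def)
      then have "Dual (c m) 0 * ?v m * (Dual (e n) 0 * ?v n) = Dual (c m * e n) 0 * ?v (m + n)"
        by (simp add: mono_val_add ac_simps)
      moreover have "Poly_Mapping.keys (m + n) \<subseteq> B"
        using M[OF that(1)] N[OF that(2)] Poly_Mapping.keys_add[of m n] by blast
      ultimately show ?thesis
        using M[OF that(1)] N[OF that(2)] ring_closedD(4)[OF k]
        by (simp add: poly_expressions_term)
    qed
    then show ?thesis
      unfolding g h sum_product by (intro sum)
  qed
  have "- 1 \<in> ?H"
    using poly_expressions_term[of "- 1" k 0 B d] ring_closedD(1,6)[OF k]
    by (simp add: uminus_dual_def)
  then have "- h \<in> ?H" if "h \<in> ?H" for h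
    using mult[OF _ that, of "- 1"] by simp
  then show ?thesis
    unfolding ring_closed_def using one mult poly_expressions_add[OF k]
    by (metis diff_conv_add_uminus)
qed

text \<open>A real part 0 is a polynomial relation among elements of \<open>B\<close>; independence
  kills every coefficient and with them the infinitesimal part.\<close>

lemma derivation_graph_poly_expressions:
  assumes k: "ring_closed k" and B: "algebraically_independent k B"
  shows "derivation_graph (poly_expressions k B d)"
  unfolding derivation_graph_def
proof (intro conjI ballI impI ring_closed_poly_expressions[OF k])
  fix h assume "h \<in> poly_expressions k B d" and h0: "re h = 0"
  then obtain M c where M: "finite M" "\<And>m. m \<in> M \<Longrightarrow> c m \<in> k \<and> Poly_Mapping.keys m \<subseteq> B"
    and h: "h = (\<Sum>m\<in>M. Dual (c m) 0 * mono_val (\<lambda>b. Dual b (d b)) m)"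
    by (auto simp: poly_expressions_def)
  define P where "P = (\<Sum>m\<in>M. Poly_Mapping.single m (c m))"
  have P: "Poly_Mapping.lookup P m = (if m \<in> M then c m else 0)" for m
    using M(1) by (auto simp: P_def lookup_sum lookup_single when_def sum.delta)
  then have keys: "Poly_Mapping.keys P \<subseteq> M" by (auto simp: in_keys_iff split: if_splits)
  have "P \<in> mpolys_over k B"
    using M(2) keys P by (auto simp: mpolys_over_def)
  moreover have "eval_mpoly P = (\<Sum>m\<in>M. c m * mono_val (\<lambda>b. b) m)"
    unfolding eval_mpoly_def mono_val_def
    using M(1) keys by (intro sum.mono_neutral_cong_left) (auto simp: P in_keys_iff)
  then have "eval_mpoly P = re h"
    by (simp add: h re_sum mono_val_def re_prod re_power)
  ultimately have "P = 0"
    using B h0 by (simp add: algebraically_independent_def)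
  then have "c m = 0" if "m \<in> M" for m
    using P[of m] that by simp
  then show "h = 0"
    by (simp add: h flip: zero_dual_def)
qed

text \<open>A maximal graph above the one over \<open>k[B]\<close> has as its domain a subfield
  containing \<open>k(B)\<close>, and separability makes this domain all of
  \<open>F\<close>.\<close>

lemma ex_derivation:
  fixes k B :: "'f::field set"
  assumes k: "is_subfield k" and B: "algebraically_independent k B"
    and sep: "\<And>x. separable_over (field_adjoin k B) x"
  shows "\<exists>D. is_derivation D \<and> (\<forall>c\<in>k. D c = 0) \<and> (\<forall>b\<in>B. D b = d b)"
proof -
  have kc: "ring_closed k" using k by (simp add: is_subfield_def is_subring_iff)
  note kD = ring_closedD[OF kc]
  obtain H where H: "derivation_graph H" and sub: "poly_expressions k B d \<subseteq> H"
    and max: "\<And>G. derivation_graph G \<Longrightarrow> H \<subseteq> G \<Longrightarrow> G = H"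
    using maximal_derivation_graph[OF derivation_graph_poly_expressions[OF kc B]] by metis
  have R: "ring_closed H" using H by (simp add: derivation_graph_def)
  have const: "Dual c 0 \<in> H" if "c \<in> k" for c
    using poly_expressions_term[of c k 0 B d] that sub by auto
  have var: "Dual b (d b) \<in> H" if "b \<in> B" for b
    using poly_expressions_term[of 1 k "Poly_Mapping.single b (Suc 0)" B d] that sub kD(1)
    by (auto simp flip: one_dual_def)
  have "is_subfield (re ` H)"
    unfolding is_subfield_def is_subring_def
  proof (intro conjI ballI)
    show "1 \<in> re ` H" using ring_closedD(1)[OF R] by force
    fix x assume x: "x \<in> re ` H"
    then show "inverse x \<in> re ` H"
      using maximal_derivation_graph_inverse[OF H max] by blast
    fix y assume "y \<in> re ` H"
    then obtain a b where "a \<in> H" "x = re a" "b \<in> H" "y = re b" using x by auto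
    then show "x - y \<in> re ` H" "x * y \<in> re ` H"
      using ring_closedD(3,4)[OF R, of a b]
      by (auto intro: rev_image_eqI[of "a - b"] rev_image_eqI[of "a * b"])
  qed
  moreover have "k \<subseteq> re ` H" "B \<subseteq> re ` H"
    using const var by force+
  ultimately have E: "field_adjoin k B \<subseteq> re ` H"
    by (rule field_adjoin_least)
  have surj: "\<exists>h\<in>H. re h = x" for x
  proof -
    obtain f where f: "f \<in> polys_in (field_adjoin k B)" "poly f x = 0" "poly (pderiv f) x \<noteq> 0"
      using separable_overE[OF is_subfield_field_adjoin sep] by blast
    then have "f \<in> polys_in (re ` H)" using E by (auto simp: polys_in_def)
    from maximal_derivation_graph_separable[OF H max this f(2,3)] show ?thesis by blast
  qed
  \<comment> \<open>The element of \<open>H\<close> above \<open>x\<close>, unique by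
    \<open>derivation_graph_inj\<close>. Uniqueness makes \<open>g\<close> a ring homomorphism,
    whose infinitesimal part is the derivation.\<close>
  define g where "g x = (SOME h. h \<in> H \<and> re h = x)" for x
  have g: "g x \<in> H" "re (g x) = x" for x
    using someI_ex[of "\<lambda>h. h \<in> H \<and> re h = x"] surj[of x] by (auto simp: g_def)
  have g_eq: "g (re h) = h" if "h \<in> H" for h
    by (rule derivation_graph_inj[OF H g(1) that g(2)])
  have "g (x + y) = g x + g y" "g (x * y) = g x * g y" for x y
    using g_eq[OF ring_closedD(5)[OF R g(1)[of x] g(1)[of y]]]
      g_eq[OF ring_closedD(4)[OF R g(1)[of x] g(1)[of y]]] by (simp_all add: g(2))
  then have "is_derivation (\<lambda>x. eps (g x))"
    by (simp add: is_derivation_def g(2))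
  moreover have "eps (g c) = 0" if "c \<in> k" for c
    using g_eq[OF const[OF that]] by simp
  moreover have "eps (g b) = d b" if "b \<in> B" for b
    using g_eq[OF var[OF that]] by simp
  ultimately show ?thesis by blast
qed

text \<open>Elements with finite support form a subfield, which contains \<open>k(B)\<close>. If
  \<open>f\<close> over \<open>k(B)\<close> has \<open>x\<close> as a simple root, a derivation that
  kills the coefficients of \<open>f\<close> kills \<open>x\<close>.\<close>

lemma finite_derivation_support:
  fixes k B :: "'f::field set"
  assumes sep: "\<And>x. separable_over (field_adjoin k B) x"
    and D: "\<And>b. b \<in> B \<Longrightarrow> is_derivation (D b)"
    and Dk: "\<And>b c. b \<in> B \<Longrightarrow> c \<in> k \<Longrightarrow> D b c = 0"
    and DB: "\<And>b c. b \<in> B \<Longrightarrow> c \<in> B \<Longrightarrow> b \<noteq> c \<Longrightarrow> D b c = 0"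
  shows "finite {b\<in>B. D b x \<noteq> 0}"
proof -
  define supp where "supp x = {b\<in>B. D b x \<noteq> 0}" for x
  have "is_subfield {x. finite (supp x)}"
    unfolding is_subfield_def is_subring_def
  proof (intro conjI ballI)
    have "supp 1 = {}" using derivation_simps(4)[OF D] by (auto simp: supp_def)
    then show "1 \<in> {x. finite (supp x)}" by simp
    fix x assume x: "x \<in> {x. finite (supp x)}"
    have "supp (inverse x) \<subseteq> supp x"
      using derivation_inverse[OF D] by (auto simp: supp_def)
    then show "inverse x \<in> {x. finite (supp x)}"
      using x finite_subset by blast
    fix y assume y: "y \<in> {x. finite (supp x)}"
    have "supp (x - y) \<subseteq> supp x \<union> supp y" "supp (x * y) \<subseteq> supp x \<union> supp y"
      using derivation_simps(2,6)[OF D] by (auto simp: supp_def)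
    then show "x - y \<in> {x. finite (supp x)}" "x * y \<in> {x. finite (supp x)}"
      using x y by (auto intro: finite_subset)
  qed
  moreover have "supp c = {}" if "c \<in> k" for c
    using Dk that by (auto simp: supp_def)
  then have "k \<subseteq> {x. finite (supp x)}" by auto
  moreover have "supp b \<subseteq> {b}" if "b \<in> B" for b
    using DB that by (auto simp: supp_def)
  then have "B \<subseteq> {x. finite (supp x)}" by (auto intro: finite_subset)
  ultimately have E: "field_adjoin k B \<subseteq> {x. finite (supp x)}"
    by (rule field_adjoin_least)
  obtain f where f: "f \<in> polys_in (field_adjoin k B)" "poly f x = 0" "poly (pderiv f) x \<noteq> 0"
    using separable_overE[OF is_subfield_field_adjoin sep] by blast
  have "D b x = 0" if b: "b \<in> B" "b \<notin> (\<Union>c\<in>set (coeffs f). supp c)" for b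
  proof -
    have "D b (coeff f i) = 0" for i
    proof (cases "coeff f i = 0")
      case False
      then have "coeff f i \<in> set (coeffs f)"
        using range_coeff[of f] by (metis insertE rangeI)
      then show ?thesis using b by (auto simp: supp_def)
    qed (simp add: derivation_simps(3)[OF D[OF b(1)]])
    from derivation_poly[OF D[OF b(1)] this, of x] show ?thesis
      using f(2,3) derivation_simps(3)[OF D[OF b(1)]] by auto
  qed
  then have "supp x \<subseteq> (\<Union>c\<in>set (coeffs f). supp c)"
    by (auto simp: supp_def)
  moreover have "finite (\<Union>c\<in>set (coeffs f). supp c)"
  proof (intro finite_UN_I ballI)
    fix c assume "c \<in> set (coeffs f)"
    then have "c \<in> range (coeff f)" by (simp add: range_coeff)
    then show "finite (supp c)"
      using f(1) E by (auto simp: polys_in_def)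
  qed simp
  ultimately show ?thesis
    unfolding supp_def using finite_subset by blast
qed

section \<open>The cardinality of \<open>F\<close>\<close>

text \<open>Builds the generated field in countably many steps, each of which is easy to bound in
  cardinality.\<close>

primrec field_stage :: "'f::field set \<Rightarrow> nat \<Rightarrow> 'f set" where
  "field_stage A 0 = A"
| "field_stage A (Suc n) =
     field_stage A n \<union> (\<lambda>(x, y). x - y) ` (field_stage A n \<times> field_stage A n) \<union>
     (\<lambda>(x, y). x * y) ` (field_stage A n \<times> field_stage A n) \<union> inverse ` field_stage A n"

lemma field_stage_mono: "m \<le> n \<Longrightarrow> field_stage A m \<subseteq> field_stage A n"
  by (rule lift_Suc_mono_le[of "field_stage A"]) auto

lemma is_subfield_UN_field_stage:
  assumes "1 \<in> A"
  shows "is_subfield (\<Union>n. field_stage A n)"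
  unfolding is_subfield_def is_subring_def
proof (intro conjI ballI)
  show "1 \<in> (\<Union>n. field_stage A n)" using assms by (auto intro!: exI[of _ 0])
  fix x assume "x \<in> (\<Union>n. field_stage A n)"
  then obtain m where m: "x \<in> field_stage A m" by auto
  then show "inverse x \<in> (\<Union>n. field_stage A n)"
    by (intro UN_I[of "Suc m"]) auto
  fix y assume "y \<in> (\<Union>n. field_stage A n)"
  then obtain n where n: "y \<in> field_stage A n" by auto
  have "x \<in> field_stage A (max m n)" "y \<in> field_stage A (max m n)"
    using m n field_stage_mono[of m "max m n" A] field_stage_mono[of n "max m n" A] by auto
  then have "x - y \<in> field_stage A (Suc (max m n))" "x * y \<in> field_stage A (Suc (max m n))"
    by auto
  then show "x - y \<in> (\<Union>n. field_stage A n)" "x * y \<in> (\<Union>n. field_stage A n)" by blast+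
qed

text \<open>\<open>F\<close> is covered by the finite root sets of nonzero polynomials over a set of
  size at most \<open>|B|\<close>, and there are at most \<open>|B|\<close> such polynomials. The
  two factors \<open>nat\<close> leave room for the labels that split \<open>B\<close> into
  layers.\<close>

lemma ex_surj_of_algebraic:
  includes cardinal_syntax
  fixes k B :: "'f::field set"
  assumes "is_subfield k" "countable k" "infinite B"
    and alg: "\<And>x. algebraic_over (field_adjoin k B) x"
  shows "\<exists>h. h ` B = (UNIV :: ('f \<times> nat \<times> nat) set)"
proof -
  have B: "infinite (Field |B| )" using assms(3) by (simp add: Field_card_of)
  note Un = card_of_Un_ordLeq_infinite_Field[OF B _ _ card_of_Card_order]
    and Times = card_of_Times_ordLeq_infinite_Field[OF B _ _ card_of_Card_order]
    and UN = card_of_UNION_ordLeq_infinite[OF assms(3)]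
  have image: "|f ` A| \<le>o |B|" if "|A| \<le>o |B|" for f :: "'x \<Rightarrow> 'y" and A
    using ordLeq_transitive[OF card_of_image that] .
  have nat: "|UNIV :: nat set| \<le>o |B|"
    using assms(3) infinite_iff_card_of_nat by blast
  have k: "|k| \<le>o |B|"
    using assms(2) nat by (meson countable_def card_of_ordLeq ordLeq_transitive subset_UNIV)
  define E where "E = (\<Union>n. field_stage (k \<union> B) n)"
  have "|field_stage (k \<union> B) n| \<le>o |B|" for n
    by (induction n) (auto intro!: Un Times image k ordLeq_refl[OF card_of_Card_order])
  then have cE: "|E| \<le>o |B|"
    unfolding E_def by (intro UN nat) auto
  have "1 \<in> k" using assms(1) by (simp add: is_subfield_def is_subring_def)
  then have E: "field_adjoin k B \<subseteq> E"
    unfolding E_def using is_subfield_UN_field_stage[of "k \<union> B"]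
    by (intro field_adjoin_least) (auto intro!: exI[of _ 0])
  \<comment> \<open>Sorts the polynomials over \<open>E\<close> by the number of
    \<open>pCons\<close> steps, so that each stage is an image of
    \<open>E \<times> Q n\<close>.\<close>
  define Q where "Q n = rec_nat {0} (\<lambda>_ Q. (\<lambda>(c, q). pCons c q) ` (E \<times> Q)) n" for n :: nat
  have Q: "Q 0 = {0}" "Q (Suc n) = (\<lambda>(c, q). pCons c q) ` (E \<times> Q n)" for n
    by (simp_all add: Q_def)
  have "|{0 :: 'f poly}| \<le>o |B|"
    using assms(3) by (metis card_of_singl_ordLeq finite.emptyI)
  then have "|Q n| \<le>o |B|" for n
    by (induction n) (auto simp: Q intro!: image Times cE)
  then have cQ: "|\<Union>n. Q n| \<le>o |B|"
    by (intro UN nat) auto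
  have polys: "q \<in> (\<Union>n. Q n)" if "set (coeffs q) \<subseteq> E" for q
    using that
  proof (induction q)
    case 0
    then show ?case by (auto simp: Q intro!: exI[of _ 0])
  next
    case (pCons c q)
    then have "set (coeffs q) \<subseteq> E" "c \<in> E" by (auto simp: cCons_def split: if_splits)
    then obtain n where "q \<in> Q n" using pCons.IH by auto
    then have "pCons c q \<in> Q (Suc n)" using \<open>c \<in> E\<close> by (auto simp: Q)
    then show ?case by blast
  qed
  \<comment> \<open>The zero polynomial is excluded because its root set is all of
    \<open>F\<close>.\<close>
  have "x \<in> (\<Union>q\<in>(\<Union>n. Q n). if q = 0 then {} else {x. poly q x = 0})" for x
  proof -
    obtain q where q: "q \<in> polys_over (field_adjoin k B)" "q \<noteq> 0" "poly q x = 0"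
      using alg[of x] by (auto simp: algebraic_over_def)
    then have "q \<in> (\<Union>n. Q n)" using E by (intro polys) (auto simp: polys_over_def)
    then show ?thesis using q by (intro UN_I[of q]) auto
  qed
  then have eq: "(UNIV :: 'f set) = (\<Union>q\<in>(\<Union>n. Q n). if q = 0 then {} else {x. poly q x = 0})"
    by blast
  have fin: "|A| \<le>o |B|" if "finite A" for A :: "'f set"
    using that assms(3) by (meson card_of_Well_order card_of_ordLeq_infinite ordLeq_total)
  have "|UNIV :: 'f set| \<le>o |B|"
    unfolding eq by (intro UN cQ ballI fin) (simp add: poly_roots_finite)
  then have "|(UNIV :: 'f set) \<times> (UNIV :: nat set) \<times> (UNIV :: nat set)| \<le>o |B|"
    by (intro Times nat)
  then show ?thesis
    using card_of_ordLeq2[of "UNIV :: ('f \<times> nat \<times> nat) set" B] by auto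
qed

section \<open>A derivation with \<open>F = S + Ker D\<close>\<close>

text \<open>The \<open>D j\<close> serve as the coordinates of one derivation with values in a space
  with countably many coordinates, finitely many of them nonzero at a time. The third clause makes
  every unit vector a value; the last one says \<open>F = S + Ker D\<close>.\<close>

lemma ex_derivation_family:
  fixes k S :: "'f::field set"
  assumes k: "is_subfield k" and char: "CHAR('f) > 0" and "countable k"
    and sg: "separably_generated k" and inf: "infinite_transcendence_degree k"
    and S: "has_quotient_field_UNIV S" "is_subring S"
  shows "\<exists>D :: nat \<Rightarrow> 'f \<Rightarrow> 'f.
    (\<forall>j. is_derivation (D j)) \<and> (\<forall>x. finite {j. D j x \<noteq> 0}) \<and>
    (\<forall>n. \<exists>t. \<forall>j. D j t = (if j = n then 1 else 0)) \<and>
    (\<forall>x. \<exists>s\<in>S. \<forall>j. D j s = D j x)"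
proof -
  define p where "p = CHAR('f)"
  have p: "p > 0" "of_nat p = (0 :: 'f)" using char by (simp_all add: p_def)
  obtain B where tb: "transcendence_basis k B"
    and sep: "\<And>x. separable_over (field_adjoin k B) x"
    using sg by (auto simp: separably_generated_def)
  have B: "infinite B" "algebraically_independent k B"
    using tb inf by (auto simp: infinite_transcendence_degree_def transcendence_basis_def)
  \<comment> \<open>Each \<open>b\<close> gets a triple: the attached element \<open>u b\<close>,
    its layer \<open>l b\<close> and, for the bottom layer, a coordinate \<open>v b\<close>. By
    surjectivity every element is attached to some \<open>b\<close> in each layer.\<close>
  obtain h :: "'f \<Rightarrow> 'f \<times> nat \<times> nat" where h: "h ` B = UNIV"
    using ex_surj_of_algebraic[OF k assms(3) B(1)] tb by (auto simp: transcendence_basis_def)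
  define u where "u b = fst (h b)" for b
  define l where "l b = fst (snd (h b))" for b
  define v where "v b = snd (snd (h b))" for b
  have surj: "\<exists>b\<in>B. u b = x \<and> l b = m \<and> v b = n" for x m n
  proof -
    have "(x, m, n) \<in> h ` B" using h by simp
    then obtain b where "b \<in> B" "h b = (x, m, n)" by auto
    then show ?thesis by (intro bexI[of _ b]) (auto simp: u_def l_def v_def)
  qed
  have "\<exists>c\<in>S - {0}. c * b \<in> S" for b
  proof -
    obtain a c where "a \<in> S" "c \<in> S - {0}" "b = a / c"
      using S(1) unfolding has_quotient_field_UNIV_def by blast
    then show ?thesis by (intro bexI[of _ c]) auto
  qed
  \<comment> \<open>\<open>c b\<close> is a denominator of \<open>b\<close> with respect to
    \<open>S\<close>.\<close>
  then obtain c where c: "\<And>b. c b \<in> S" "\<And>b. c b \<noteq> 0" "\<And>b. c b * b \<in> S"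
    by (metis DiffD1 DiffD2 singletonI)
  have "\<exists>P. is_derivation P \<and> (\<forall>a\<in>k. P a = 0) \<and> (\<forall>b'\<in>B. P b' = (if b' = b then 1 else 0))" for b
    by (rule ex_derivation[OF k B(2) sep])
  then obtain P where P: "\<And>b. is_derivation (P b)" "\<And>b a. a \<in> k \<Longrightarrow> P b a = 0"
    and PB: "\<And>b b'. b' \<in> B \<Longrightarrow> P b b' = (if b' = b then 1 else 0)"
    by metis
  define supp where "supp x = {b\<in>B. P b x \<noteq> 0}" for x
  have fin: "finite (supp x)" for x
    unfolding supp_def by (rule finite_derivation_support[OF sep P]) (auto simp: PB)
  \<comment> \<open>The derivation with value \<open>e b\<close> at each \<open>b\<close> in
    \<open>B\<close>; the sum is finite by \<open>fin\<close>.\<close>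
  define Der where "Der e x = (\<Sum>b\<in>supp x. e b * P b x)" for e :: "'f \<Rightarrow> 'f" and x
  have Der_superset: "Der e x = (\<Sum>b\<in>A. e b * P b x)" if "finite A" "supp x \<subseteq> A" "A \<subseteq> B" for e x A
    unfolding Der_def using that by (intro sum.mono_neutral_left) (auto simp: supp_def)
  have Der: "is_derivation (Der e)" for e
    unfolding is_derivation_def
  proof (intro conjI allI)
    fix x y
    let ?A = "supp x \<union> supp y"
    have A: "finite ?A" "supp x \<subseteq> ?A" "supp y \<subseteq> ?A" "?A \<subseteq> B"
      "supp (x + y) \<subseteq> ?A" "supp (x * y) \<subseteq> ?A"
      using derivation_simps(1,2)[OF P(1)] fin by (auto simp: supp_def)
    show "Der e (x + y) = Der e x + Der e y"
      using A by (simp add: Der_superset[of ?A] derivation_simps(1)[OF P(1)] distrib_left sum.distrib)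
    show "Der e (x * y) = x * Der e y + y * Der e x"
      using A by (simp add: Der_superset[of ?A] derivation_simps(2)[OF P(1)] distrib_left sum.distrib
          sum_distrib_left mult_ac)
  qed
  have Der_B: "Der e b = e b" if "b \<in> B" for e b
    using that PB by (subst Der_superset[of "{b}"]) (auto simp: supp_def)
  have Der_cong: "Der e x = Der e' x" if "\<And>b. b \<in> supp x \<Longrightarrow> e b = e' b" for e e' x
    unfolding Der_def using that by simp

  txt \<open>The value at \<open>b\<close> is chosen, once the layers below \<open>l b\<close> are settled, so that
    \<open>c\<^sup>p b \<in> S\<close> and \<open>u b\<close> have the same derivative: \<open>c\<^sup>p\<close> is a constant in characteristic \<open>p\<close>.\<close>

  define d :: "nat \<Rightarrow> 'f \<Rightarrow> nat \<Rightarrow> 'f" where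
    "d n = rec_nat (\<lambda>b j. if l b = 0 \<and> j = v b then 1 else 0)
       (\<lambda>n e b. if l b = Suc n then \<lambda>j. Der (\<lambda>b. e b j) (u b) / c b ^ p else e b) n" for n
  have d0: "d 0 b j = (if l b = 0 \<and> j = v b then 1 else 0)" for b j
    by (simp add: d_def)
  have dSuc: "d (Suc n) b = (if l b = Suc n then \<lambda>j. Der (\<lambda>b. d n b j) (u b) / c b ^ p else d n b)"
    for n b by (simp add: d_def)
  \<comment> \<open>Stage \<open>Suc n\<close> of the recursion changes only layer
    \<open>Suc n\<close>, so the value at \<open>b\<close> is final from stage \<open>l b\<close>
    on.\<close>
  have d_stable: "d n b = d (l b) b" if "l b \<le> n" for n b
    using that by (induction n rule: dec_induct) (auto simp: dSuc)
  have Der_fin: "finite {j. Der (\<lambda>b. e b j) x \<noteq> 0}" if "\<And>b. finite {j. e b j \<noteq> 0}"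
    for e :: "'f \<Rightarrow> nat \<Rightarrow> 'f" and x
  proof (rule finite_subset)
    show "{j. Der (\<lambda>b. e b j) x \<noteq> 0} \<subseteq> (\<Union>b\<in>supp x. {j. e b j \<noteq> 0})"
      unfolding Der_def using sum.neutral by fastforce
    show "finite (\<Union>b\<in>supp x. {j. e b j \<noteq> 0})" using fin that by blast
  qed
  have d_fin: "finite {j. d n b j \<noteq> 0}" for n b
  proof (induction n arbitrary: b)
    case 0
    have "{j. d 0 b j \<noteq> 0} \<subseteq> {v b}" by (auto simp: d0)
    then show ?case by (rule finite_subset) simp
  next
    case (Suc n)
    then show ?case
      using Der_fin[of "d n" "u b"] by (auto simp: dSuc c(2))
  qed
  define D where "D j = Der (\<lambda>b. d (l b) b j)" for j
  have D: "is_derivation (D j)" for j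
    unfolding D_def by (rule Der)
  have D_B: "D j b = d (l b) b j" if "b \<in> B" for j b
    using that by (simp add: D_def Der_B)
  show ?thesis
  proof (intro exI[of _ D] conjI allI)
    show "is_derivation (D j)" for j by (rule D)
    show "finite {j. D j x \<noteq> 0}" for x
      unfolding D_def by (rule Der_fin) (rule d_fin)
    show "\<exists>t. \<forall>j. D j t = (if j = n then 1 else 0)" for n
    proof -
      obtain b where "b \<in> B" "l b = 0" "v b = n" using surj by blast
      then show ?thesis by (intro exI[of _ b]) (simp add: D_B d0)
    qed
    show "\<exists>s\<in>S. \<forall>j. D j s = D j x" for x
    proof -
      \<comment> \<open>Bounds the layers that \<open>x\<close> involves. If the support is empty,
        the value of \<open>Max\<close> is arbitrary and the bound holds vacuously.\<close>
      define n where "n = Max (l ` supp x)"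
      have n: "l b \<le> n" if "b \<in> supp x" for b
        unfolding n_def using fin[of x] that by (intro Max_ge) auto
      \<comment> \<open>One layer above those of \<open>x\<close>: the value at \<open>b\<close> was
        set when the values on the support of \<open>x\<close> were already final.\<close>
      obtain b where b: "b \<in> B" "u b = x" "l b = Suc n" using surj by blast
      have "D j (c b ^ p * b) = D j x" for j
      proof -
        have "D j (c b ^ p * b) = c b ^ p * D j b"
          using derivation_simps(2,7)[OF D] p(2) by simp
        also have "D j b = Der (\<lambda>b. d n b j) x / c b ^ p"
          using b by (simp add: D_B dSuc)
        also have "Der (\<lambda>b. d n b j) x = D j x"
          unfolding D_def by (intro Der_cong) (simp add: d_stable[OF n])
        finally show ?thesis using c(2) by simp
      qed
      \<comment> \<open>One factor \<open>c b\<close> clears the denominator of \<open>b\<close>; it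
        can be split off since \<open>p > 0\<close>.\<close>
      moreover have "c b ^ p * b = c b ^ (p - 1) * (c b * b)"
        using p(1) by (simp add: power_eq_if)
      moreover have "c b ^ (p - 1) * (c b * b) \<in> S"
        using c S(2) ring_closedD(4,7)[of S] by (simp add: is_subring_iff)
      ultimately show ?thesis by metis
    qed
  qed
qed

section \<open>Derivations into the divisible hull\<close>

lemma tensor_relations_closed:
  "0 \<in> tensor_relations S smul"
  "c \<in> tensor_relations S smul \<Longrightarrow> d \<in> tensor_relations S smul \<Longrightarrow> c + d \<in> tensor_relations S smul"
  "c \<in> tensor_relations S smul \<Longrightarrow> d \<in> tensor_relations S smul \<Longrightarrow> c - d \<in> tensor_relations S smul"
  by (auto simp: tensor_relations_def group_closure_add intro: group_closure.diff)

lemma tensor_relations_sum: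
  "(\<And>i. i \<in> I \<Longrightarrow> f i \<in> tensor_relations S smul) \<Longrightarrow> (\<Sum>i\<in>I. f i) \<in> tensor_relations S smul"
  by (induction I rule: infinite_finite_induct) (auto simp: tensor_relations_closed)

lemma coset_eq_iff:
  "c +o tensor_relations S smul = d +o tensor_relations S smul \<longleftrightarrow> c - d \<in> tensor_relations S smul"
  (is "c +o ?N = d +o ?N \<longleftrightarrow> _")
proof
  assume eq: "c +o ?N = d +o ?N"
  have "c \<in> c +o ?N" using tensor_relations_closed(1) by (force simp: elt_set_plus_def)
  then show "c - d \<in> ?N" unfolding eq by (auto simp: elt_set_plus_def)
next
  have sub: "c +o ?N \<subseteq> d +o ?N" if "c - d \<in> ?N" for c d
  proof
    fix y assume "y \<in> c +o ?N"
    then obtain n where "n \<in> ?N" "y = c + n" by (auto simp: elt_set_plus_def)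
    then have "y = d + (c - d + n)" "c - d + n \<in> ?N"
      using that tensor_relations_closed(2) by auto
    then show "y \<in> d +o ?N" unfolding elt_set_plus_def by blast
  qed
  assume "c - d \<in> ?N"
  moreover from this have "d - c \<in> ?N"
    using tensor_relations_closed(3)[OF tensor_relations_closed(1)] by fastforce
  ultimately show "c +o ?N = d +o ?N" using sub by blast
qed

lemma coset_zero: "0 +o tensor_relations S smul = tensor_relations S smul"
  by (simp add: elt_set_plus_def)

lemma coset_eq_zero_iff:
  "c +o tensor_relations S smul = tensor_relations S smul \<longleftrightarrow> c \<in> tensor_relations S smul"
  using coset_eq_iff[of c S smul 0] by (simp add: coset_zero)

lemma tensor_relators_in_relations:
  "c \<in> tensor_relators S smul \<Longrightarrow> c \<in> tensor_relations S smul"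
  unfolding tensor_relations_def by (auto intro: group_closure.base)

text \<open>Additivity in the scalar holds modulo the relators \<open>add_left\<close>, in contrast
  to \<open>free_scale_mult_scalar\<close>, which is an equation in the free group.\<close>

lemma free_scale_add_scalar:
  "free_scale (a + b) c - (free_scale a c + free_scale b c) \<in> tensor_relations S smul"
  using subset_UNIV
proof (induction c rule: frag_induction)
  case zero
  then show ?case by (simp add: free_scale_def tensor_relations_closed)
next
  case (one y)
  obtain e m where y: "y = (e, m)" by (cases y)
  have "frag_of (a * e + b * e, m) - frag_of (a * e, m) - frag_of (b * e, m)
      \<in> tensor_relations S smul"
    by (intro tensor_relators_in_relations tensor_relators.add_left)
  then show ?case by (simp add: y free_scale_of distrib_right diff_diff_eq)
next
  case (diff c d)
  from tensor_relations_closed(3)[OF diff.IH] show ?case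
    by (simp add: free_scale_diff algebra_simps)
qed

lemma free_scale_zero_scalar: "free_scale 0 c \<in> tensor_relations S smul"
  using tensor_relations_closed(3)[OF tensor_relations_closed(1)
      free_scale_add_scalar[of 0 0 c S smul]] by simp

lemma free_scale_zero: "free_scale a 0 = 0"
  by (simp add: free_scale_def)

lemma free_scale_mult_scalar: "free_scale (a * b) c = free_scale a (free_scale b c)"
  using subset_UNIV by (induction c rule: frag_induction)
    (auto simp: free_scale_of free_scale_diff mult.assoc free_scale_zero)

lemma free_scale_one [simp]: "free_scale 1 c = c"
  using subset_UNIV by (induction c rule: frag_induction)
    (auto simp: free_scale_of free_scale_diff free_scale_zero)

lemma free_scale_sum: "free_scale a (\<Sum>i\<in>I. f i) = (\<Sum>i\<in>I. free_scale a (f i))"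
  by (induction I rule: infinite_finite_induct)
    (auto simp: free_scale_add free_scale_zero)

text \<open>The vector of the hull with coordinates \<open>a j\<close> relative to the classes of
  \<open>x j\<close>. The sum is taken on representatives, because an empty sum of cosets would be
  \<open>{0}\<close> instead of the zero coset.\<close>

definition hull_combination ::
    "'f::field set \<Rightarrow> ('f \<Rightarrow> 'm::ab_group_add \<Rightarrow> 'm) \<Rightarrow> (nat \<Rightarrow> ('f \<times> 'm \<Rightarrow>\<^sub>0 int)) \<Rightarrow>
     (nat \<Rightarrow> 'f) \<Rightarrow> ('f \<times> 'm \<Rightarrow>\<^sub>0 int) set" where
  "hull_combination S smul x a =
     (\<Sum>j | a j \<noteq> 0. free_scale (a j) (x j)) +o tensor_relations S smul"

text \<open>Each extra index contributes a multiple by the scalar 0, which is a relation, though in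
  general not 0 in the free group.\<close>

lemma hull_combination_superset:
  assumes "finite J" "{j. a j \<noteq> 0} \<subseteq> J"
  shows "hull_combination S smul x a =
    (\<Sum>j\<in>J. free_scale (a j) (x j)) +o tensor_relations S smul"
proof -
  have "(\<Sum>j\<in>J. free_scale (a j) (x j)) =
      (\<Sum>j | a j \<noteq> 0. free_scale (a j) (x j)) + (\<Sum>j\<in>J - {j. a j \<noteq> 0}. free_scale (a j) (x j))"
    using assms by (simp add: sum.subset_diff add.commute)
  moreover have "(\<Sum>j\<in>J - {j. a j \<noteq> 0}. free_scale (a j) (x j)) \<in> tensor_relations S smul"
    by (intro tensor_relations_sum) (auto simp: free_scale_zero_scalar)
  ultimately have "(\<Sum>j\<in>J. free_scale (a j) (x j)) - (\<Sum>j | a j \<noteq> 0. free_scale (a j) (x j))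
      \<in> tensor_relations S smul" by simp
  then show ?thesis
    by (simp add: hull_combination_def coset_eq_iff[symmetric])
qed

lemma hull_combination_add:
  assumes "finite {j. a j \<noteq> 0}" "finite {j. b j \<noteq> 0}"
  shows "hull_combination S smul x (\<lambda>j. a j + b j) =
    hull_combination S smul x a + hull_combination S smul x b"
proof -
  let ?J = "{j. a j \<noteq> 0} \<union> {j. b j \<noteq> 0}"
  have "(\<Sum>j\<in>?J. free_scale (a j + b j) (x j)) -
      ((\<Sum>j\<in>?J. free_scale (a j) (x j)) + (\<Sum>j\<in>?J. free_scale (b j) (x j)))
      \<in> tensor_relations S smul"
    unfolding sum.distrib[symmetric] sum_subtractf[symmetric]
    by (intro tensor_relations_sum free_scale_add_scalar)
  then have "(\<Sum>j\<in>?J. free_scale (a j + b j) (x j)) +o tensor_relations S smul =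
      hull_combination S smul x a + hull_combination S smul x b"
    using assms by (simp add: hull_combination_superset[of ?J] coset_add coset_eq_iff)
  moreover have "{j. a j + b j \<noteq> 0} \<subseteq> ?J" by auto
  ultimately show ?thesis
    using assms by (simp add: hull_combination_superset[of ?J])
qed

lemma hull_combination_scale:
  assumes "finite {j. a j \<noteq> 0}"
  shows "hull_combination S smul x (\<lambda>j. c * a j) = hull_scale S smul c (hull_combination S smul x a)"
proof -
  have "hull_combination S smul x (\<lambda>j. c * a j) =
      (\<Sum>j | a j \<noteq> 0. free_scale (c * a j) (x j)) +o tensor_relations S smul"
    using assms by (intro hull_combination_superset) auto
  also have "\<dots> = hull_scale S smul c (hull_combination S smul x a)"
    by (simp add: hull_combination_def hull_scale_coset free_scale_sum free_scale_mult_scalar)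
  finally show ?thesis .
qed

lemma hull_combination_zero: "hull_combination S smul x (\<lambda>_. 0) = tensor_relations S smul"
  by (simp add: hull_combination_def coset_zero)

text \<open>The sum and product rules are inherited coordinatewise.\<close>

lemma hull_derivation_combination:
  assumes D: "\<And>j. is_derivation (D j)" and fin: "\<And>f. finite {j. D j f \<noteq> 0}"
  shows "hull_derivation S smul (\<lambda>f. hull_combination S smul x (\<lambda>j. D j f))"
  unfolding hull_derivation_def
proof (intro conjI allI)
  show "range (\<lambda>f. hull_combination S smul x (\<lambda>j. D j f)) \<subseteq> div_hull S smul"
    by (auto simp: hull_combination_def div_hull_def)
  fix f g
  show "hull_combination S smul x (\<lambda>j. D j (f + g)) =
      hull_combination S smul x (\<lambda>j. D j f) + hull_combination S smul x (\<lambda>j. D j g)"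
    by (simp add: derivation_simps(1)[OF D] hull_combination_add fin)
  have fin': "finite {j. a * D j y \<noteq> 0}" for a y
    using fin[of y] by (rule rev_finite_subset) auto
  show "hull_combination S smul x (\<lambda>j. D j (f * g)) =
      hull_scale S smul f (hull_combination S smul x (\<lambda>j. D j g)) +
      hull_scale S smul g (hull_combination S smul x (\<lambda>j. D j f))"
    by (simp add: derivation_simps(2)[OF D] hull_combination_add hull_combination_scale fin fin')
qed

section \<open>Subspaces, the image of \<open>K\<close>, and its preimage under a derivation\<close>

lemma hull_subspace_div_hull: "hull_subspace S smul (div_hull S smul)"
proof -
  have "tensor_relations S smul \<in> div_hull S smul"
    unfolding div_hull_def using coset_zero by (metis rangeI)
  then show ?thesis
    by (auto simp: hull_subspace_def div_hull_def coset_add hull_scale_coset)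
qed

lemma hull_span_mono:
  "(\<And>W. hull_subspace S smul W \<Longrightarrow> Y \<subseteq> W \<Longrightarrow> X \<subseteq> W) \<Longrightarrow> hull_span S smul X \<subseteq> hull_span S smul Y"
  by (auto simp: hull_span_def)

text \<open>The relators \<open>add_right\<close> and \<open>balanced\<close> make the image of
  \<open>K\<close> an \<open>S\<close>-submodule; the instance of \<open>add_right\<close> at 0
  supplies the zero coset.\<close>

lemma hull_base_closed:
  "tensor_relations S smul \<in> hull_base S smul"
  "A \<in> hull_base S smul \<Longrightarrow> B \<in> hull_base S smul \<Longrightarrow> A + B \<in> hull_base S smul"
  "s \<in> S \<Longrightarrow> A \<in> hull_base S smul \<Longrightarrow> hull_scale S smul s A \<in> hull_base S smul"
proof -
  let ?N = "tensor_relations S smul"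
  have add: "tensor S smul 1 x + tensor S smul 1 y = tensor S smul 1 (x + y)" for x y
    unfolding tensor_def coset_add coset_eq_iff
    using tensor_relations_closed(3)[OF tensor_relations_closed(1)
        tensor_relators_in_relations[OF tensor_relators.add_right[of 1 x y S smul]]]
    by (simp add: algebra_simps)
  then show "A \<in> hull_base S smul \<Longrightarrow> B \<in> hull_base S smul \<Longrightarrow> A + B \<in> hull_base S smul"
    by (auto simp: hull_base_def)
  have "- frag_of (1, 0) \<in> ?N"
    using tensor_relators_in_relations[OF tensor_relators.add_right[of 1 0 0 S smul]] by simp
  then have "frag_of (1, 0) \<in> ?N"
    using tensor_relations_closed(3)[OF tensor_relations_closed(1)] by fastforce
  then have "tensor S smul 1 0 = ?N"
    by (simp add: tensor_def coset_eq_zero_iff)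
  then show "?N \<in> hull_base S smul"
    unfolding hull_base_def by (metis rangeI)
  have "hull_scale S smul s (tensor S smul 1 x) = tensor S smul 1 (smul s x)" if "s \<in> S" for s x
    unfolding tensor_def hull_scale_coset coset_eq_iff free_scale_of
    using tensor_relators_in_relations[OF tensor_relators.balanced[OF that, of 1 x smul]] by simp
  then show "s \<in> S \<Longrightarrow> A \<in> hull_base S smul \<Longrightarrow> hull_scale S smul s A \<in> hull_base S smul"
    by (auto simp: hull_base_def)
qed

text \<open>For \<open>f\<close> and \<open>g\<close> in the preimage, the product rule value
  \<open>f D g + g D f\<close> stays in the image of \<open>K\<close>, because that image is an
  \<open>S\<close>-submodule.\<close>

lemma is_subring_derivation_preimage:
  assumes D: "hull_derivation S smul D" and S: "is_subring S"
  shows "is_subring (S \<inter> D -` hull_base S smul)"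
proof -
  have R: "ring_closed S" using S by (simp add: is_subring_iff)
  note S = ring_closedD[OF R]
  have add: "D (f + g) = D f + D g"
    and mult: "D (f * g) = hull_scale S smul f (D g) + hull_scale S smul g (D f)" for f g
    using D by (auto simp: hull_derivation_def)
  have cos: "\<exists>c. D f = c +o tensor_relations S smul" for f
  proof -
    have "D f \<in> div_hull S smul" using D by (auto simp: hull_derivation_def)
    then show ?thesis by (auto simp: div_hull_def)
  qed
  \<comment> \<open>Addition of sets does not cancel, so the vanishing of a value is read off from
    idempotence by way of representatives.\<close>
  have idem: "D f = tensor_relations S smul" if "D f + D f = D f" for f
  proof -
    obtain c where c: "D f = c +o tensor_relations S smul" using cos by blast
    then have "c + c - c \<in> tensor_relations S smul"
      using that by (simp only: coset_add coset_eq_iff)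
    then show ?thesis
      by (simp add: c coset_eq_zero_iff)
  qed
  have scale1: "hull_scale S smul 1 (D f) = D f" for f
  proof -
    obtain c where "D f = c +o tensor_relations S smul" using cos by blast
    then show ?thesis by (simp add: hull_scale_coset)
  qed
  have D1: "D 1 = tensor_relations S smul"
    using idem[of 1] mult[of 1 1] by (simp add: scale1)
  have D0: "D 0 = tensor_relations S smul"
    using idem[of 0] add[of 0 0] by simp
  let ?R = "S \<inter> D -` hull_base S smul"
  have Rmult: "x * y \<in> ?R" if "x \<in> ?R" "y \<in> ?R" for x y
    using that unfolding Int_iff vimage_eq mult
    by (intro conjI S(4) hull_base_closed(2,3)) auto
  \<comment> \<open>Negation is multiplication by \<open>- 1\<close>, so closure under differences
    reduces to \<open>D (- 1)\<close> being zero.\<close>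
  have Dm1: "D (- 1) = tensor_relations S smul"
  proof -
    obtain c where c: "D (- 1) = c +o tensor_relations S smul" using cos by blast
    have "tensor_relations S smul = D (- 1) + D 1"
      using add[of "- 1" 1] D0 by simp
    also have "\<dots> = c +o tensor_relations S smul"
      unfolding c D1 using coset_add[of c S smul 0] by (simp add: coset_zero)
    finally show ?thesis using c by simp
  qed
  have one: "1 \<in> ?R" using D1 S(1) hull_base_closed(1) by auto
  then have neg1: "- 1 \<in> ?R"
    using Dm1 S(1,6) hull_base_closed(1) by auto
  have "x - y \<in> ?R" if "x \<in> ?R" "y \<in> ?R" for x y
  proof -
    have "- y \<in> ?R" using Rmult[OF neg1 that(2)] by simp
    then have "x + (- y) \<in> ?R"
      using that S(5) hull_base_closed(2) unfolding Int_iff vimage_eq add by blast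
    then show ?thesis by simp
  qed
  then show ?thesis using one Rmult by (auto simp: is_subring_def)
qed

section \<open>Construction of the strongly twisted subring\<close>

theorem theorem3p5:
  fixes k S :: "'f::field set"
    and smul :: "'f \<Rightarrow> 'm::ab_group_add \<Rightarrow> 'm"
  assumes "is_subfield k"
    and "CHAR('f) > 0"
    and "countable k"
    and "separably_generated k"
    and "infinite_transcendence_degree k"
    and "is_subalgebra k S"
    and "has_quotient_field_UNIV S"
    and "module_over S smul"
    and "torsion_free S smul"
    and "countable_rank S smul"
  shows "\<exists>R. strongly_twisted S smul R"
proof -
  let ?N = "tensor_relations S smul"
  have S: "is_subring S" using assms(6) by (simp add: is_subalgebra_def)
  have SR: "ring_closed S" using S by (simp add: is_subring_iff)
  obtain D :: "nat \<Rightarrow> 'f \<Rightarrow> 'f" where "\<forall>j. is_derivation (D j)"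
    and "\<forall>x. finite {j. D j x \<noteq> 0}"
    and "\<forall>n. \<exists>t. \<forall>j. D j t = (if j = n then 1 else 0)"
    and "\<forall>x. \<exists>s\<in>S. \<forall>j. D j s = D j x"
    using ex_derivation_family[OF assms(1-5,7) S] by blast
  then have D: "\<And>j. is_derivation (D j)"
    and fin: "\<And>x. finite {j. D j x \<noteq> 0}"
    and unit: "\<And>n. \<exists>t. \<forall>j. D j t = (if j = n then 1 else 0)"
    and dense: "\<And>x. \<exists>s\<in>S. \<forall>j. D j s = D j x"
    by blast+
  obtain X where X: "countable X" "X \<subseteq> div_hull S smul" "hull_span S smul X = div_hull S smul"
    using assms(10) by (auto simp: countable_rank_def hull_basis_def)
  have "?N \<in> div_hull S smul"
    using hull_subspace_div_hull by (auto simp: hull_subspace_def)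
  then have sub: "insert ?N X \<subseteq> div_hull S smul"
    using X(2) by simp
  \<comment> \<open>Inserting the zero coset makes the set nonempty, so that it can be enumerated by
    \<open>nat\<close> even when \<open>X\<close> is empty.\<close>
  have e: "range (from_nat_into (insert ?N X)) = insert ?N X"
    using X(1) by (intro range_from_nat_into) auto
  have "\<exists>c. from_nat_into (insert ?N X) j = c +o ?N" for j
  proof -
    have "from_nat_into (insert ?N X) j \<in> div_hull S smul"
      using sub by (intro subsetD[OF sub] from_nat_into) simp
    then show ?thesis by (auto simp: div_hull_def)
  qed
  then obtain x where x: "\<And>j. from_nat_into (insert ?N X) j = x j +o ?N" by metis
  define E where "E f = hull_combination S smul x (\<lambda>j. D j f)" for f
  have E: "hull_derivation S smul E"
    unfolding E_def by (rule hull_derivation_combination[OF D fin])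
  have "x n +o ?N \<in> range E" for n
  proof -
    \<comment> \<open>An element whose coordinates form the \<open>n\<close>-th unit vector is sent
      to the \<open>n\<close>-th vector of the enumeration.\<close>
    obtain t where t: "\<And>j. D j t = (if j = n then 1 else 0)" using unit by blast
    have "E t = x n +o ?N"
      by (simp add: E_def hull_combination_superset[of "{n}"] t)
    then show ?thesis by (metis rangeI)
  qed
  then have "range (from_nat_into (insert ?N X)) \<subseteq> range E"
    by (intro image_subsetI) (simp only: x)
  then have "X \<subseteq> range E"
    unfolding e by simp
  then have "hull_span S smul X \<subseteq> hull_span S smul (range E)"
    by (intro hull_span_mono) auto
  moreover have "hull_span S smul (range E) \<subseteq> div_hull S smul"
    using hull_subspace_div_hull E by (auto simp: hull_span_def hull_derivation_def)
  ultimately have span: "hull_span S smul (range E) = div_hull S smul"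
    using X(3) by blast
  have twist: "S \<subseteq> hull_kernel S smul E + s *o S" if s: "s \<in> S - {0}" for s
  proof
    fix t assume "t \<in> S"
    define p where "p = CHAR('f)"
    have p: "p > 0" "of_nat p = (0 :: 'f)" using assms(2) by (simp_all add: p_def)
    \<comment> \<open>Here \<open>t / s ^ p - r\<close> lies in the kernel; multiplication by the
      constant \<open>s ^ p\<close> carries this over to \<open>t - s ^ p * r\<close>.\<close>
    obtain r where r: "r \<in> S" "\<And>j. D j r = D j (t / s ^ p)" using dense by blast
    have "D j (t - s ^ p * r) = 0" for j
    proof -
      have pth: "D j (s ^ p * y) = s ^ p * D j y" for y
        using derivation_simps(2,7)[OF D] p(2) by simp
      have "D j t = s ^ p * D j (t / s ^ p)"
        using pth[of "t / s ^ p"] s by simp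
      then show ?thesis by (simp add: derivation_simps(6)[OF D] pth r(2))
    qed
    then have "t - s ^ p * r \<in> hull_kernel S smul E"
      by (simp add: hull_kernel_def E_def hull_combination_zero)
    \<comment> \<open>Since \<open>p > 0\<close>, one factor \<open>s\<close> can be taken out,
      which puts the second summand into \<open>s *o S\<close>.\<close>
    moreover have "s ^ p * r = s * (s ^ (p - 1) * r)"
      using p(1) by (simp add: power_eq_if)
    then have "s ^ p * r \<in> s *o S"
      using s r(1) ring_closedD(4,7)[OF SR] by (auto simp: elt_set_times_def)
    ultimately have "(t - s ^ p * r) + s ^ p * r \<in> hull_kernel S smul E + s *o S"
      by (rule set_plus_intro)
    then show "t \<in> hull_kernel S smul E + s *o S" by simp
  qed
  have "strongly_twisted S smul (S \<inter> E -` hull_base S smul)"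
    unfolding strongly_twisted_def
    using is_subring_derivation_preimage[OF E S] E span twist by blast
  then show ?thesis by blast
qed

end
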